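(* For each fixed $q\ge 3$, the transition for the existence of a $q$-core in a random graph has characteristic width at least $\Theta(\sqrt{n})$. That is, for every $\varepsilon\in(0,1/2)$ there is a constant $c>0$ (depending on $q$ and $\varepsilon$) such that $\Delta_\varepsilon(n)\ge c\sqrt{n}$ for all sufficiently large $n$.
   Context: The random graph on $n$ vertices with $m$ edges is obtained by selecting $m$ uniformly random edges from the $\binom{n}{2}$ possible edges, either without replacement or with replacement (in the latter case existence of a $q$-core is a property of the set of edges that occur). The $q$-core of a graph is the maximal subgraph in which every vertex has degree at least $q$; "existence of a $q$-core" means that this subgraph is nonempty. Characteristic width: for $0<r<1$ let $m_r(n)$ be the smallest $m$ for which the random graph on $n$ vertices with $m$ edges has a $q$-core with probability $\ge r$. For $0<\varepsilon<1/2$ the characteristic width is $\Delta_\varepsilon(n)=m_{1-\varepsilon}(n)-m_\varepsilon(n)$, i.e. the amount by which $m$ must be increased for the probability of having a $q$-core to rise from $\varepsilon$ to $1-\varepsilon$. *)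

theory Defs
  imports "HOL-Probability.Probability"
begin

text \<open>
  A graph is a pair of a vertex set and an edge set, an edge being the set of its endpoints.
\<close>

type_synonym 'a ugraph = "'a set \<times> 'a set set"

definition simple_graph :: "'a ugraph \<Rightarrow> bool" where
  "simple_graph G \<longleftrightarrow> finite (fst G) \<and> (\<forall>e\<in>snd G. e \<subseteq> fst G \<and> card e = 2)"

definition subgraph :: "'a ugraph \<Rightarrow> 'a ugraph \<Rightarrow> bool" where
  "subgraph H G \<longleftrightarrow> simple_graph H \<and> fst H \<subseteq> fst G \<and> snd H \<subseteq> snd G"

definition degree :: "'a ugraph \<Rightarrow> 'a \<Rightarrow> nat" where
  "degree G v = card {e \<in> snd G. v \<in> e}"

definition min_degree_ge :: "nat \<Rightarrow> 'a ugraph \<Rightarrow> bool" where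
  "min_degree_ge q G \<longleftrightarrow> (\<forall>v\<in>fst G. q \<le> degree G v)"

text \<open>
  The empty graph vacuously has minimum degree at least \<open>q\<close>, so the core always exists as a
  possibly empty graph (see \<open>ex1_core\<close> below).
\<close>

definition is_core :: "nat \<Rightarrow> 'a ugraph \<Rightarrow> 'a ugraph \<Rightarrow> bool" where
  "is_core q G H \<longleftrightarrow>
     subgraph H G \<and> min_degree_ge q H \<and>
     (\<forall>K. subgraph K G \<and> min_degree_ge q K \<and> subgraph H K \<longrightarrow> K = H)"

definition has_core :: "nat \<Rightarrow> 'a ugraph \<Rightarrow> bool" where
  "has_core q G \<longleftrightarrow> (\<exists>H. is_core q G H \<and> fst H \<noteq> {})"

lemma ex1_core:
  assumes G: "simple_graph G"
  shows "\<exists>!H. is_core q G H"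
proof -
  define S where "S = {K. subgraph K G \<and> min_degree_ge q K}"
  define U where "U = (\<Union>K\<in>S. fst K, \<Union>K\<in>S. snd K)"
  have finG: "finite (fst G)" "finite (snd G)"
  proof -
    show f: "finite (fst G)" using G by (simp add: simple_graph_def)
    have "snd G \<subseteq> Pow (fst G)" using G by (auto simp: simple_graph_def)
    then show "finite (snd G)" using f finite_subset by blast
  qed
  have USG: "fst U \<subseteq> fst G" "snd U \<subseteq> snd G"
    by (auto simp: U_def S_def subgraph_def)
  have "e \<subseteq> fst U \<and> card e = 2" if "e \<in> snd U" for e
  proof -
    from that obtain K where K: "K \<in> S" "e \<in> snd K" by (auto simp: U_def)
    then have "e \<subseteq> fst K" "card e = 2" by (auto simp: S_def subgraph_def simple_graph_def)
    then show ?thesis using K(1) by (auto simp: U_def)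
  qed
  then have sgU: "simple_graph U"
    using finite_subset[OF USG(1) finG(1)] unfolding simple_graph_def by blast
  have subU: "subgraph U G" using sgU USG by (simp add: subgraph_def)
  have below: "subgraph K U" if "K \<in> S" for K
    using that by (auto simp: subgraph_def U_def S_def)
  have mdU: "min_degree_ge q U"
    unfolding min_degree_ge_def
  proof
    fix v assume "v \<in> fst U"
    then obtain K where K: "K \<in> S" "v \<in> fst K" by (auto simp: U_def)
    have "q \<le> degree K v" using K by (auto simp: S_def min_degree_ge_def)
    also have "\<dots> \<le> degree U v" unfolding degree_def
      using below[OF K(1)] finite_subset[OF USG(2) finG(2)]
      by (intro card_mono) (auto simp: subgraph_def)
    finally show "q \<le> degree U v" .
  qed
  have anti: "K = H" if "subgraph H K" "subgraph K H" for H K :: "'a ugraph"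
    using that by (auto simp: subgraph_def prod_eq_iff)
  show ?thesis
  proof (rule ex1I[of _ U])
    show "is_core q G U" unfolding is_core_def
      using subU mdU below anti by (auto simp: S_def)
    fix H assume "is_core q G H"
    then show "H = U" unfolding is_core_def
      using subU mdU below by (metis (mono_tags, lifting) S_def mem_Collect_eq)
  qed
qed

definition all_edges :: "nat \<Rightarrow> nat set set" where
  "all_edges n = {e. e \<subseteq> {..<n} \<and> card e = 2}"

datatype sampling = Without_Replacement | With_Replacement

text \<open>
  Whether \<open>m\<close> edges can be drawn from the \<open>n choose 2\<close> possible ones.  Outside this range
  the distributions below are meaningless, as they involve \<open>pmf_of_set {}\<close>.
\<close>

fun can_draw :: "sampling \<Rightarrow> nat \<Rightarrow> nat \<Rightarrow> bool" where
  "can_draw Without_Replacement n m \<longleftrightarrow> m \<le> n choose 2"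
| "can_draw With_Replacement n m \<longleftrightarrow> n choose 2 > 0 \<or> m = 0"

fun random_edges :: "sampling \<Rightarrow> nat \<Rightarrow> nat \<Rightarrow> nat set set pmf" where
  "random_edges Without_Replacement n m = pmf_of_set {F. F \<subseteq> all_edges n \<and> card F = m}"
| "random_edges With_Replacement n m = map_pmf set (replicate_pmf m (pmf_of_set (all_edges n)))"

definition core_prob :: "sampling \<Rightarrow> nat \<Rightarrow> nat \<Rightarrow> nat \<Rightarrow> real" where
  "core_prob s q n m = measure_pmf.prob (random_edges s n m) {F. has_core q ({..<n}, F)}"

text \<open>
  For \<open>n \<le> q\<close> no graph on \<open>n\<close> vertices has a nonempty core and the value for \<open>r > 0\<close> is
  unspecified; for \<open>n > q\<close> and \<open>r < 1\<close> a suitable \<open>m\<close> exists, since the complete graph is its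
  own core.
\<close>

definition core_threshold :: "sampling \<Rightarrow> nat \<Rightarrow> real \<Rightarrow> nat \<Rightarrow> nat" where
  "core_threshold s q r n = (LEAST m. can_draw s n m \<and> r \<le> core_prob s q n m)"

definition characteristic_width :: "sampling \<Rightarrow> nat \<Rightarrow> real \<Rightarrow> nat \<Rightarrow> real" where
  "characteristic_width s q \<epsilon> n =
     real (core_threshold s q (1 - \<epsilon>) n) - real (core_threshold s q \<epsilon> n)"

end

theory Submission
  imports Defs
begin

text \<open>
  Let \<open>f\<close> be the indicator of having a \<open>q\<close>-core.  An edge that ends in a vertex of degree one does
  not affect \<open>f\<close>, so double counting the ways to remove such an edge from, or to attach it to, a
  random graph gives \<open>E\<^sub>m\<^sub>+\<^sub>1[f L] = \<kappa> E\<^sub>m[f I]\<close>, where \<open>L\<close> and \<open>I\<close> count the vertices of degree one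
  and the isolated vertices and \<open>\<kappa>\<close> does not depend on \<open>f\<close>.  Taking \<open>f = 1\<close> shows that \<open>E\<^sub>m\<^sub>+\<^sub>1\<close> of
  \<open>f\<close> weighted by \<open>L / E\<^sub>m\<^sub>+\<^sub>1[L]\<close> equals \<open>E\<^sub>m\<close> of \<open>f\<close> weighted by \<open>I / E\<^sub>m[I]\<close>.  For \<open>m = O(n)\<close> both weights
  have standard deviation \<open>O(1 / sqrt n)\<close> around 1, so one further edge changes the probability of
  a core by only \<open>O(1 / sqrt n)\<close>.  As \<open>2 q n\<close> edges force a core with high probability, the whole transition
  lies in this range of \<open>m\<close>.
\<close>

subsection \<open>Drawing edges one at a time\<close>

text \<open>Unnormalised weight of \<open>e\<close> as the next draw after \<open>F\<close>. This
  weight carries the difference between the two models, so that most arguments treat both at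
  once.\<close>

definition urn_weight :: "sampling \<Rightarrow> 'a multiset \<Rightarrow> 'a \<Rightarrow> real" where
  "urn_weight s F e = (if s = Without_Replacement \<and> e \<in># F then 0 else 1)"

text \<open>The loss of total urn weight per draw, which makes
  \<open>card E - depletion s * m\<close> the normalising constant after \<open>m\<close>
  draws.\<close>

definition depletion :: "sampling \<Rightarrow> real" where
  "depletion s = of_bool (s = Without_Replacement)"

text \<open>
  The expectation of \<open>g\<close> over the multiset of the first \<open>m\<close> drawn edges, taken over the last draw
  first.  Without replacement this requires \<open>m \<le> card E\<close>, as the denominator vanishes beyond.
\<close>

primrec draw_exp :: "sampling \<Rightarrow> 'a set \<Rightarrow> nat \<Rightarrow> ('a multiset \<Rightarrow> real) \<Rightarrow> real" where
  "draw_exp s E 0 g = g {#}"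
| "draw_exp s E (Suc m) g =
     draw_exp s E m (\<lambda>F. (\<Sum>e\<in>E. urn_weight s F e * g (add_mset e F))
                          / (real (card E) - depletion s * real m))"

text \<open>Contains every outcome of \<open>m\<close> draws that has nonzero weight; the equation
  with \<open>mset_set\<close> says that no element occurs twice.\<close>

definition drawable :: "sampling \<Rightarrow> 'a set \<Rightarrow> nat \<Rightarrow> 'a multiset \<Rightarrow> bool" where
  "drawable s E m F \<longleftrightarrow> size F = m \<and> set_mset F \<subseteq> E \<and>
     (s = Without_Replacement \<longrightarrow> F = mset_set (set_mset F))"

lemma urn_weight_nonneg [simp]: "0 \<le> urn_weight s F e"
  by (simp add: urn_weight_def)

lemma depletion_cases: "depletion s = 0 \<or> depletion s = 1"
  by (simp add: depletion_def)

lemma urn_denominator_nonneg: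
  "m \<le> card E \<Longrightarrow> 0 \<le> real (card E) - depletion s * real m"
  using depletion_cases[of s] by auto

lemma urn_denominator_pos:
  "m < card E \<Longrightarrow> 0 < real (card E) - depletion s * real m"
  using depletion_cases[of s] by auto

lemma drawable_add:
  assumes "drawable s E m F" "e \<in> E" "urn_weight s F e \<noteq> 0"
  shows "drawable s E (Suc m) (add_mset e F)"
proof -
  have "add_mset e F = mset_set (insert e (set_mset F))" if s: "s = Without_Replacement"
  proof -
    have "e \<notin> set_mset F"
      using assms(3) s by (simp add: urn_weight_def split: if_splits)
    then have "mset_set (insert e (set_mset F)) = add_mset e (mset_set (set_mset F))"
      by (simp add: mset_set.insert)
    then show ?thesis
      using assms(1) s unfolding drawable_def by metis
  qed
  then show ?thesis
    using assms unfolding drawable_def by auto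
qed

lemma draw_exp_cong:
  assumes "\<And>F. drawable s E m F \<Longrightarrow> f F = g F"
  shows "draw_exp s E m f = draw_exp s E m g"
  using assms
proof (induction m arbitrary: f g)
  case 0
  then show ?case by (simp add: drawable_def)
next
  case (Suc m)
  have "(\<Sum>e\<in>E. urn_weight s F e * f (add_mset e F)) = (\<Sum>e\<in>E. urn_weight s F e * g (add_mset e F))"
    if "drawable s E m F" for F
    using drawable_add[OF that] Suc.prems by (intro sum.cong) auto
  then show ?case by (auto intro!: Suc.IH)
qed

lemma draw_exp_mono:
  assumes "\<And>F. drawable s E m F \<Longrightarrow> f F \<le> g F" "m \<le> card E"
  shows "draw_exp s E m f \<le> draw_exp s E m g"
  using assms
proof (induction m arbitrary: f g)
  case 0
  then show ?case by (simp add: drawable_def)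
next
  case (Suc m)
  have "(\<Sum>e\<in>E. urn_weight s F e * f (add_mset e F)) \<le> (\<Sum>e\<in>E. urn_weight s F e * g (add_mset e F))"
    if "drawable s E m F" for F
  proof (intro sum_mono)
    fix e assume "e \<in> E"
    then show "urn_weight s F e * f (add_mset e F) \<le> urn_weight s F e * g (add_mset e F)"
      using drawable_add[OF that] Suc.prems
      by (cases "urn_weight s F e = 0") (auto intro!: mult_left_mono)
  qed
  then show ?case
    using urn_denominator_nonneg[of m E s] Suc.prems(2)
    by (auto intro!: Suc.IH divide_right_mono)
qed

lemma draw_exp_linear:
  "draw_exp s E m (\<lambda>F. a * f F + b * g F) = a * draw_exp s E m f + b * draw_exp s E m g"
proof (induction m arbitrary: f g)
  case (Suc m)
  have "(\<Sum>e\<in>E. urn_weight s F e * (a * f (add_mset e F) + b * g (add_mset e F))) / d =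
      a * ((\<Sum>e\<in>E. urn_weight s F e * f (add_mset e F)) / d)
      + b * ((\<Sum>e\<in>E. urn_weight s F e * g (add_mset e F)) / d)" for F d
    by (simp add: sum_distrib_left sum.distrib algebra_simps add_divide_distrib)
  then show ?case by (simp only: draw_exp.simps Suc.IH)
qed auto

lemma draw_exp_cmult: "draw_exp s E m (\<lambda>F. a * f F) = a * draw_exp s E m f"
  using draw_exp_linear[of s E m a f 0 f] by simp

lemma draw_exp_add: "draw_exp s E m (\<lambda>F. f F + g F) = draw_exp s E m f + draw_exp s E m g"
  using draw_exp_linear[of s E m 1 f 1 g] by simp

lemma draw_exp_diff: "draw_exp s E m (\<lambda>F. f F - g F) = draw_exp s E m f - draw_exp s E m g"
  using draw_exp_linear[of s E m 1 f "-1" g] by simp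

lemma draw_exp_divide: "draw_exp s E m (\<lambda>F. f F / a) = draw_exp s E m f / a"
  using draw_exp_cmult[of s E m "1 / a" f] by simp

lemma draw_exp_zero: "draw_exp s E m (\<lambda>F. 0) = 0"
  using draw_exp_cmult[of s E m 0 "\<lambda>F. 0"] by simp

lemma draw_exp_sum:
  "finite A \<Longrightarrow> draw_exp s E m (\<lambda>F. \<Sum>i\<in>A. f i F) = (\<Sum>i\<in>A. draw_exp s E m (f i))"
  by (induction A rule: finite_induct) (auto simp: draw_exp_add draw_exp_zero)

text \<open>Stated for any \<open>T\<close> containing the drawn elements, because the weight left
  inside a subset of \<open>E\<close> is wanted as well.\<close>

lemma sum_urn_weight:
  assumes "finite T" "drawable s E m F" "set_mset F \<subseteq> T"
  shows "(\<Sum>e\<in>T. urn_weight s F e) = real (card T) - depletion s * real m"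
proof (cases s)
  case Without_Replacement
  then have "F = mset_set (set_mset F)" "size F = m"
    using assms(2) by (auto simp: drawable_def)
  then have m: "card (set_mset F) = m"
    by (metis finite_set_mset size_mset_set)
  have "(\<Sum>e\<in>T. urn_weight s F e) = (\<Sum>e\<in>T - set_mset F. 1)"
    by (intro sum.mono_neutral_cong_right)
       (auto simp: Without_Replacement urn_weight_def assms(1))
  also have "\<dots> = real (card T - m)"
    using assms(1,3) m by (simp add: card_Diff_subset)
  finally show ?thesis
    using m card_mono[OF assms(1,3)] by (simp add: Without_Replacement depletion_def)
next
  case With_Replacement
  then show ?thesis by (simp add: urn_weight_def depletion_def)
qed

text \<open>While all draws stay in \<open>T\<close>, the next one does so with the ratio of the
  weights left in \<open>T\<close> and in \<open>E\<close>; the chain rule multiplies these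
  ratios.\<close>

lemma draw_exp_subset:
  assumes "finite E" "T \<subseteq> E"
  shows "draw_exp s E m (\<lambda>F. of_bool (set_mset F \<subseteq> T)) =
    (\<Prod>j<m. (real (card T) - depletion s * real j) / (real (card E) - depletion s * real j))"
proof (induction m)
  case (Suc m)
  have "(\<Sum>e\<in>E. urn_weight s F e * of_bool (set_mset (add_mset e F) \<subseteq> T)) =
      (real (card T) - depletion s * real m) * of_bool (set_mset F \<subseteq> T)"
    if "drawable s E m F" for F
  proof (cases "set_mset F \<subseteq> T")
    case True
    then have "(\<Sum>e\<in>E. urn_weight s F e * of_bool (set_mset (add_mset e F) \<subseteq> T)) =
        (\<Sum>e\<in>T. urn_weight s F e)"
      using assms by (intro sum.mono_neutral_cong_right) auto
    then show ?thesis
      using True sum_urn_weight[OF _ that True] finite_subset[OF assms(2,1)] by simp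
  qed auto
  then have "draw_exp s E (Suc m) (\<lambda>F. of_bool (set_mset F \<subseteq> T)) =
      draw_exp s E m (\<lambda>F. (real (card T) - depletion s * real m)
        / (real (card E) - depletion s * real m) * of_bool (set_mset F \<subseteq> T))"
    unfolding draw_exp.simps by (intro draw_exp_cong) simp
  then show ?case
    by (simp only: draw_exp_cmult Suc.IH prod.lessThan_Suc) (simp only: mult.commute)
qed auto

text \<open>Normalisation is the case \<open>T = E\<close> of \<open>draw_exp_subset\<close>; the
  bound on \<open>m\<close> keeps the denominators positive.\<close>

lemma draw_exp_const:
  assumes "finite E" "m \<le> card E"
  shows "draw_exp s E m (\<lambda>F. c) = c"
proof -
  have "draw_exp s E m (\<lambda>F. 1) = draw_exp s E m (\<lambda>F. of_bool (set_mset F \<subseteq> E))"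
    by (intro draw_exp_cong) (auto simp: drawable_def)
  also have "\<dots> = (\<Prod>j<m. 1)"
    unfolding draw_exp_subset[OF assms(1) order_refl]
  proof (intro prod.cong refl)
    fix j assume "j \<in> {..<m}"
    then have "0 < real (card E) - depletion s * real j"
      using assms(2) by (intro urn_denominator_pos) auto
    then show "(real (card E) - depletion s * real j) / (real (card E) - depletion s * real j) = 1"
      by simp
  qed
  finally show ?thesis
    using draw_exp_cmult[of s E m c "\<lambda>F. 1"] by simp
qed

text \<open>Distinguishes whether the marked element is the copy drawn last or an earlier
  one.\<close>

lemma sum_mset_draw_add:
  fixes h :: "'a multiset \<Rightarrow> 'a \<Rightarrow> real"
  shows "(\<Sum>e\<in>#add_mset a F. h (add_mset a F - {#e#}) e) =
    h F a + (\<Sum>e\<in>#F. h (add_mset a (F - {#e#})) e)"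
proof -
  have "(\<Sum>e\<in>#F. h (add_mset a F - {#e#}) e) = (\<Sum>e\<in>#F. h (add_mset a (F - {#e#})) e)"
    by (intro arg_cong[of _ _ sum_mset] image_mset_cong)
       (metis add_mset_remove_trivial insert_DiffM add_mset_commute)
  then show ?thesis by simp
qed

lemma sum_sum_mset_swap:
  fixes h :: "'a \<Rightarrow> 'b \<Rightarrow> real"
  assumes "finite A"
  shows "(\<Sum>a\<in>A. \<Sum>e\<in>#F. h a e) = (\<Sum>e\<in>#F. \<Sum>a\<in>A. h a e)"
  using assms by (induction F) (auto simp: sum.distrib)

text \<open>Two successive draws have the same weight in either order; exchangeability rests on
  this.\<close>

lemma urn_weight_swap:
  "urn_weight s G e * urn_weight s (add_mset e G) a = urn_weight s G a * urn_weight s (add_mset a G) e"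
  by (auto simp: urn_weight_def)

text \<open>Exchangeability: each of the drawn edges may be regarded as the last one.\<close>

lemma draw_exp_delete:
  assumes "finite E"
  shows "draw_exp s E (Suc m) (\<lambda>F. \<Sum>e\<in>#F. h (F - {#e#}) e) =
    real (Suc m) / (real (card E) - depletion s * real m)
      * draw_exp s E m (\<lambda>G. \<Sum>e\<in>E. urn_weight s G e * h G e)"
proof (induction m arbitrary: h)
  case 0
  then show ?case by simp
next
  case (Suc m)
  define d where "d k = real (card E) - depletion s * real k" for k
  \<comment> \<open>The last draw is either the marked edge or another one. In the second case
    \<open>h'\<close> sums over that last draw, and the induction hypothesis applies to
    \<open>h'\<close>.\<close>
  define h' where "h' G e = (\<Sum>a\<in>E. urn_weight s (add_mset e G) a * h (add_mset a G) e)" for G e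
  have inner: "(\<Sum>a\<in>E. urn_weight s F a * (\<Sum>e\<in>#F. h (add_mset a (F - {#e#})) e))
      = (\<Sum>e\<in>#F. h' (F - {#e#}) e)" for F
  proof -
    have "(\<Sum>a\<in>E. urn_weight s F a * (\<Sum>e\<in>#F. h (add_mset a (F - {#e#})) e))
      = (\<Sum>e\<in>#F. \<Sum>a\<in>E. urn_weight s F a * h (add_mset a (F - {#e#})) e)"
      using sum_sum_mset_swap[OF assms] by (simp add: sum_mset_distrib_left)
    also have "\<dots> = (\<Sum>e\<in>#F. h' (F - {#e#}) e)"
      by (intro arg_cong[of _ _ sum_mset] image_mset_cong) (simp add: h'_def)
    finally show ?thesis .
  qed
  have swap: "(\<Sum>e\<in>E. urn_weight s G e * h' G e) =
      (\<Sum>a\<in>E. urn_weight s G a * (\<Sum>e\<in>E. urn_weight s (add_mset a G) e * h (add_mset a G) e))" for G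
    unfolding h'_def sum_distrib_left
    by (subst sum.swap) (simp add: mult.assoc[symmetric] urn_weight_swap)
  have "draw_exp s E (Suc (Suc m)) (\<lambda>F. \<Sum>e\<in>#F. h (F - {#e#}) e) =
      draw_exp s E (Suc m) (\<lambda>F. ((\<Sum>a\<in>E. urn_weight s F a * h F a)
         + (\<Sum>e\<in>#F. h' (F - {#e#}) e)) / d (Suc m))"
    unfolding draw_exp.simps(2)[of s E "Suc m"] sum_mset_draw_add d_def
    by (simp only: distrib_left sum.distrib inner)
  also have "\<dots> = (draw_exp s E (Suc m) (\<lambda>F. \<Sum>a\<in>E. urn_weight s F a * h F a)
      + draw_exp s E (Suc m) (\<lambda>F. \<Sum>e\<in>#F. h' (F - {#e#}) e)) / d (Suc m)"
    by (simp only: draw_exp_divide draw_exp_add)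
  also have "draw_exp s E (Suc m) (\<lambda>F. \<Sum>e\<in>#F. h' (F - {#e#}) e) =
      real (Suc m) * draw_exp s E (Suc m) (\<lambda>F. \<Sum>e\<in>E. urn_weight s F e * h F e)"
    unfolding Suc.IH swap draw_exp.simps(2)[of s E m] draw_exp_divide by simp
  finally show ?case
    unfolding d_def by (simp add: field_simps)
qed

subsection \<open>The two sampling models\<close>

text \<open>\<open>replicate_pmf\<close> averages over the head of the list outside the remaining
  draws, \<open>draw_exp\<close> averages inside them; linearity reconciles the two.\<close>

lemma expectation_replicate_pmf:
  assumes "finite E" "E \<noteq> {}"
  shows "measure_pmf.expectation (replicate_pmf m (pmf_of_set E)) (\<lambda>l. g (mset l)) =
    draw_exp With_Replacement E m g"
proof (induction m arbitrary: g)
  case (Suc m)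
  have fin: "finite (set_pmf (replicate_pmf m (pmf_of_set E)))"
    by (rule finite_subset[of _ "{l. set l \<subseteq> E \<and> length l = m}"])
       (use assms in \<open>auto simp: set_replicate_pmf intro: finite_lists_length_eq\<close>)
  have "measure_pmf.expectation (replicate_pmf (Suc m) (pmf_of_set E)) (\<lambda>l. g (mset l)) =
      (\<Sum>e\<in>E. draw_exp With_Replacement E m (\<lambda>F. g (add_mset e F))) / real (card E)"
    using assms fin
    by (simp add: map_pmf_def[symmetric] pmf_expectation_bind_pmf_of_set
        Suc.IH[symmetric] divide_inverse sum_distrib_left mult.commute)
  then show ?case
    using assms by (simp add: urn_weight_def depletion_def draw_exp_divide draw_exp_sum)
qed auto

text \<open>Drawing without replacement gives a uniform \<open>m\<close>-subset: each set of size
  \<open>m + 1\<close> arises from exactly \<open>m + 1\<close> pairs of a smaller set and a last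
  element.\<close>

lemma sum_subsets_draw_exp:
  assumes "finite E" "m \<le> card E"
  shows "(\<Sum>F | F \<subseteq> E \<and> card F = m. g (mset_set F)) =
    real (card E choose m) * draw_exp Without_Replacement E m g"
  using assms(2)
proof (induction m arbitrary: g)
  case 0
  have "{F. F \<subseteq> E \<and> card F = 0} = {{}}"
    using assms(1) by (auto dest: finite_subset)
  then show ?case by simp
next
  case (Suc m)
  let ?P = "\<lambda>m. {F. F \<subseteq> E \<and> card F = m}"
  have finP: "finite (?P k)" for k using assms(1) by simp
  have finF: "finite F" if "F \<subseteq> E" for F
    using that assms(1) by (rule finite_subset)
  then have fin: "finite F" if "F \<in> ?P k" for F k
    using that by simp
  have pos: "real (card E) - real m > 0" using Suc.prems by simp
  have "real (card E choose m) * draw_exp Without_Replacement E (Suc m) g =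
      (\<Sum>G\<in>?P m. (\<Sum>e\<in>E. urn_weight Without_Replacement (mset_set G) e * g (add_mset e (mset_set G)))
        / (real (card E) - real m))"
    using Suc.IH[of "\<lambda>F. (\<Sum>e\<in>E. urn_weight Without_Replacement F e * g (add_mset e F))
        / (real (card E) - real m)"] Suc.prems by (simp add: depletion_def)
  also have "\<dots> = (\<Sum>G\<in>?P m. \<Sum>e\<in>E - G. g (mset_set (insert e G))) / (real (card E) - real m)"
  proof -
    have "(\<Sum>e\<in>E. urn_weight Without_Replacement (mset_set G) e * g (add_mset e (mset_set G)))
        = (\<Sum>e\<in>E - G. g (mset_set (insert e G)))" if "G \<in> ?P m" for G
      using fin[OF that] assms(1)
      by (intro sum.mono_neutral_cong_right) (auto simp: urn_weight_def)
    then show ?thesis by (simp flip: sum_divide_distrib)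
  qed
  also have "(\<Sum>G\<in>?P m. \<Sum>e\<in>E - G. g (mset_set (insert e G))) =
      (\<Sum>(G,e)\<in>Sigma (?P m) (\<lambda>G. E - G). g (mset_set (insert e G)))"
    using finP assms(1) by (simp add: sum.Sigma)
  also have "\<dots> = (\<Sum>(F,e)\<in>Sigma (?P (Suc m)) (\<lambda>F. F). g (mset_set F))"
  proof (rule sum.reindex_bij_witness[of _ "\<lambda>(F,e). (F - {e}, e)" "\<lambda>(G,e). (insert e G, e)"])
    fix x assume "x \<in> Sigma (?P m) (\<lambda>G. E - G)"
    then obtain G e where x: "x = (G, e)" and G: "G \<subseteq> E" "card G = m" "e \<in> E" "e \<notin> G" by auto
    then show "(case case x of (G, e) \<Rightarrow> (insert e G, e) of (F, e) \<Rightarrow> (F - {e}, e)) = x"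
      "(case x of (G, e) \<Rightarrow> (insert e G, e)) \<in> Sigma (?P (Suc m)) (\<lambda>F. F)"
      using finF[OF G(1)] by simp_all
    show "(case case x of (G, e) \<Rightarrow> (insert e G, e) of (F, e) \<Rightarrow> g (mset_set F)) =
        (case x of (G, e) \<Rightarrow> g (mset_set (insert e G)))"
      by (simp add: x)
  next
    fix y assume "y \<in> Sigma (?P (Suc m)) (\<lambda>F. F)"
    then obtain F e where y: "y = (F, e)" and F: "F \<subseteq> E" "card F = Suc m" "e \<in> F" by auto
    then show "(case case y of (F, e) \<Rightarrow> (F - {e}, e) of (G, e) \<Rightarrow> (insert e G, e)) = y"
      by (simp add: insert_absorb)
    show "(case y of (F, e) \<Rightarrow> (F - {e}, e)) \<in> Sigma (?P m) (\<lambda>G. E - G)"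
      using F by (auto simp: y)
  qed
  also have "\<dots> = (\<Sum>F\<in>?P (Suc m). \<Sum>e\<in>F. g (mset_set F))"
    by (rule sum.Sigma[symmetric]) (use finP fin in blast)+
  also have "\<dots> = real (Suc m) * (\<Sum>F\<in>?P (Suc m). g (mset_set F))"
    by (simp add: sum_distrib_left)
  finally have "real (card E choose m) * (real (card E) - real m)
      * draw_exp Without_Replacement E (Suc m) g =
      real (Suc m) * (\<Sum>F\<in>?P (Suc m). g (mset_set F))"
    using pos by (simp add: field_simps)
  moreover have "real (card E choose m) * (real (card E) - real m)
      = real (Suc m) * real (card E choose Suc m)"
  proof -
    have "Suc m * (card E choose Suc m) = (card E - m) * (card E choose m)"
      by (simp only: binomial_absorption binomial_absorb_comp)
    then have "real (Suc m) * real (card E choose Suc m) = real (card E - m) * real (card E choose m)"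
      by (metis of_nat_mult)
    then show ?thesis using Suc.prems by (simp add: mult.commute)
  qed
  ultimately show ?case by simp
qed

lemma card_all_edges: "card (all_edges n) = n choose 2"
  unfolding all_edges_def using n_subsets[of "{..<n}" 2] by simp

lemma finite_all_edges [simp]: "finite (all_edges n)"
  unfolding all_edges_def by simp

lemma core_prob_draw_exp:
  assumes "m \<le> n choose 2" "0 < n choose 2"
  shows "core_prob s q n m =
    draw_exp s (all_edges n) m (\<lambda>F. of_bool (has_core q ({..<n}, set_mset F)))"
proof (cases s)
  case Without_Replacement
  let ?P = "{F. F \<subseteq> all_edges n \<and> card F = m}"
  have ne: "?P \<noteq> {}" "finite ?P"
    using assms obtain_subset_with_card_n[of m "all_edges n"] by (auto simp: card_all_edges)
  have c: "card ?P = (n choose 2) choose m"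
    using n_subsets[of "all_edges n" m] by (simp add: card_all_edges)
  have "(\<Sum>F\<in>?P. of_bool (has_core q ({..<n}, set_mset (mset_set F)))) =
      (\<Sum>F\<in>?P. of_bool (has_core q ({..<n}, F)) :: real)"
    by (intro sum.cong refl) (auto dest: finite_subset[OF _ finite_all_edges])
  also have "\<dots> = real (card (?P \<inter> {F. has_core q ({..<n}, F)}))"
    using ne by (simp add: Int_def)
  finally have "real (card (?P \<inter> {F. has_core q ({..<n}, F)})) = real ((n choose 2) choose m)
      * draw_exp s (all_edges n) m (\<lambda>F. of_bool (has_core q ({..<n}, set_mset F)))"
    using sum_subsets_draw_exp[of "all_edges n" m "\<lambda>F. of_bool (has_core q ({..<n}, set_mset F))"]
      assms Without_Replacement by (simp add: card_all_edges)
  moreover have "real ((n choose 2) choose m) > 0" using assms by simp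
  ultimately show ?thesis
    using ne c Without_Replacement by (simp add: core_prob_def measure_pmf_of_set)
next
  case With_Replacement
  have ne: "all_edges n \<noteq> {}" using assms(2) card_all_edges[of n] by force
  let ?R = "replicate_pmf m (pmf_of_set (all_edges n))"
  have "core_prob s q n m = measure_pmf.prob ?R {l. has_core q ({..<n}, set l)}"
    by (simp add: core_prob_def With_Replacement vimage_def)
  also have "\<dots> = measure_pmf.expectation ?R (indicator {l. has_core q ({..<n}, set l)})"
    by simp
  also have "\<dots> = measure_pmf.expectation ?R (\<lambda>l. of_bool (has_core q ({..<n}, set_mset (mset l))))"
    by (intro Bochner_Integration.integral_cong) (auto simp: indicator_def)
  finally show ?thesis
    using With_Replacement
      expectation_replicate_pmf[OF finite_all_edges ne, of m "\<lambda>F. of_bool (has_core q ({..<n}, set_mset F))"]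
    by simp
qed

subsection \<open>Cores\<close>

text \<open>A finite graph has finitely many subgraphs, so any witness lies below a maximal one. The
  componentwise order on pairs serves as the subgraph order.\<close>

lemma has_core_iff:
  assumes "finite (fst G)"
  shows "has_core q G \<longleftrightarrow> (\<exists>K. subgraph K G \<and> min_degree_ge q K \<and> fst K \<noteq> {})"
proof
  assume "has_core q G"
  then show "\<exists>K. subgraph K G \<and> min_degree_ge q K \<and> fst K \<noteq> {}"
    unfolding has_core_def is_core_def by blast
next
  assume "\<exists>K. subgraph K G \<and> min_degree_ge q K \<and> fst K \<noteq> {}"
  then obtain K where K: "subgraph K G" "min_degree_ge q K" "fst K \<noteq> {}" by blast
  define S where "S = {L. subgraph L G \<and> min_degree_ge q L}"
  have "S \<subseteq> Pow (fst G) \<times> Pow (Pow (fst G))"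
    by (fastforce simp: S_def subgraph_def simple_graph_def)
  then have "finite S"
    using assms by (meson finite_Pow_iff finite_SigmaI finite_subset)
  moreover have "K \<in> S" using K by (simp add: S_def)
  ultimately obtain M where M: "M \<in> S" "K \<le> M" "\<And>L. L \<in> S \<Longrightarrow> M \<le> L \<Longrightarrow> M = L"
    using finite_has_maximal2[of S K] by auto
  then have "is_core q G M"
    unfolding is_core_def S_def subgraph_def less_eq_prod_def by blast
  moreover have "fst M \<noteq> {}"
    using K(3) M(2) by (auto simp: less_eq_prod_def)
  ultimately show "has_core q G" unfolding has_core_def by blast
qed

text \<open>The vertex \<open>v\<close> has degree at most one in the larger graph, so no subgraph
  of minimum degree two contains \<open>v\<close>, and hence none contains \<open>e\<close>.\<close>

lemma has_core_insert_pendant: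
  assumes "finite V" "2 \<le> q" "v \<in> e" "\<And>a. a \<in> F \<Longrightarrow> v \<notin> a"
  shows "has_core q (V, insert e F) \<longleftrightarrow> has_core q (V, F)"
proof -
  have "snd K \<subseteq> F" if K: "subgraph K (V, insert e F)" "min_degree_ge q K" for K
  proof -
    have "v \<notin> fst K"
    proof
      assume "v \<in> fst K"
      then have "2 \<le> card {a \<in> snd K. v \<in> a}"
        using K(2) assms(2) by (auto simp: min_degree_ge_def degree_def)
      also have "\<dots> \<le> card {e}"
        using K(1) assms(4) by (intro card_mono) (auto simp: subgraph_def)
      finally show False by simp
    qed
    then have "e \<notin> snd K"
      using K(1) assms(3) by (auto simp: subgraph_def simple_graph_def)
    then show ?thesis using K(1) by (auto simp: subgraph_def)
  qed
  then have "subgraph K (V, insert e F) \<and> min_degree_ge q K \<longleftrightarrow>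
      subgraph K (V, F) \<and> min_degree_ge q K" for K
    unfolding subgraph_def fst_conv snd_conv by blast
  then show ?thesis
    using assms(1) by (simp add: has_core_iff flip: conj_assoc)
qed

lemma not_has_core_no_edges:
  assumes "finite V" "0 < q"
  shows "\<not> has_core q (V, {})"
  using assms by (auto simp: has_core_iff subgraph_def min_degree_ge_def degree_def)

text \<open>Peeling: deleting a vertex of degree below \<open>q\<close> preserves the ratio of at
  least \<open>q\<close> edges per vertex.\<close>

lemma dense_graph_has_min_degree_subgraph:
  assumes "simple_graph (V, F)" "V \<noteq> {}" "q * card V \<le> card F"
  shows "\<exists>K. subgraph K (V, F) \<and> min_degree_ge q K \<and> fst K \<noteq> {}"
proof -
  have "finite V" using assms(1) by (simp add: simple_graph_def)
  then show ?thesis using assms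
  proof (induction V arbitrary: F rule: finite_psubset_induct)
    case (psubset V)
    have "F \<subseteq> Pow V" using psubset.prems(1) by (auto simp: simple_graph_def)
    then have finF: "finite F" using psubset.hyps(1) finite_subset by blast
    show ?case
    proof (cases "min_degree_ge q (V, F)")
      case True
      then show ?thesis
        using psubset.prems by (intro exI[of _ "(V, F)"]) (auto simp: subgraph_def)
    next
      case False
      then obtain v where v: "v \<in> V" "card {e \<in> F. v \<in> e} < q"
        by (auto simp: min_degree_ge_def degree_def)
      define F' where "F' = {e \<in> F. v \<notin> e}"
      have "card F = card (F' \<union> {e \<in> F. v \<in> e})"
        by (rule arg_cong[of _ _ card]) (auto simp: F'_def)
      also have "\<dots> = card F' + card {e \<in> F. v \<in> e}"
        using finF by (intro card_Un_disjoint) (auto simp: F'_def)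
      finally have cF: "card F = card F' + card {e \<in> F. v \<in> e}" .
      have cV: "card V = Suc (card (V - {v}))"
        using psubset.hyps(1) v(1) by (rule card.remove)
      \<comment> \<open>Fewer than \<open>q\<close> edges disappear with \<open>v\<close>. The
        strict inequality leaves at least one edge, so the vertices cannot run out.\<close>
      have le: "q * card (V - {v}) < card F'"
        using psubset.prems(3) v(2) unfolding cF cV by simp
      have sg: "simple_graph (V - {v}, F')"
        using psubset.prems(1) by (auto simp: simple_graph_def F'_def)
      have "V - {v} \<noteq> {}"
      proof
        assume "V - {v} = {}"
        then have "card e = 2 \<and> e \<subseteq> {}" if "e \<in> F'" for e
          using sg that by (auto simp: simple_graph_def)
        then have "F' = {}" by fastforce
        then show False using le by simp
      qed
      then have "\<exists>K. subgraph K (V - {v}, F') \<and> min_degree_ge q K \<and> fst K \<noteq> {}"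
        using v le by (intro psubset.IH sg) auto
      then obtain K where "subgraph K (V - {v}, F')" "min_degree_ge q K" "fst K \<noteq> {}" by blast
      then show ?thesis
        by (intro exI[of _ K]) (auto simp: subgraph_def F'_def)
    qed
  qed
qed

lemma dense_graph_has_core:
  assumes "simple_graph (V, F)" "V \<noteq> {}" "q * card V \<le> card F"
  shows "has_core q (V, F)"
  using dense_graph_has_min_degree_subgraph[OF assms] assms(1)
  by (subst has_core_iff) (auto simp: simple_graph_def)

subsection \<open>Isolated vertices and leaves\<close>

text \<open>Counts repeated draws, so an edge drawn twice makes no leaves and deleting one draw at a
  leaf always isolates it.\<close>

definition mdeg :: "'a set multiset \<Rightarrow> 'a \<Rightarrow> nat" where
  "mdeg F v = size {#e \<in># F. v \<in> e#}"

definition isolated_count :: "nat \<Rightarrow> nat set multiset \<Rightarrow> real" where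
  "isolated_count n F = (\<Sum>v<n. of_bool (mdeg F v = 0))"

definition leaf_count :: "nat \<Rightarrow> nat set multiset \<Rightarrow> real" where
  "leaf_count n F = (\<Sum>v<n. of_bool (mdeg F v = 1))"

lemma mdeg_add [simp]: "mdeg (add_mset e F) v = mdeg F v + of_bool (v \<in> e)"
  by (simp add: mdeg_def)

lemma mdeg_eq_0_iff: "mdeg F v = 0 \<longleftrightarrow> (\<forall>e\<in>#F. v \<notin> e)"
  by (auto simp: mdeg_def filter_mset_eq_conv)

lemma isolated_count_add: "isolated_count n (add_mset e F) \<le> isolated_count n F"
  unfolding isolated_count_def by (intro sum_mono) auto

text \<open>Only the two ends of \<open>e\<close> can become leaves. This slack enters the second
  moment of \<open>leaf_count\<close>.\<close>

lemma leaf_count_add: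
  assumes "card e = 2"
  shows "leaf_count n (add_mset e F) \<le> leaf_count n F + 2"
proof -
  have "finite e" using assms by (metis card.infinite zero_neq_numeral)
  have "leaf_count n (add_mset e F) \<le> (\<Sum>v<n. of_bool (mdeg F v = 1) + of_bool (v \<in> e))"
    unfolding leaf_count_def by (intro sum_mono) auto
  also have "\<dots> = leaf_count n F + real (card ({..<n} \<inter> e))"
    by (simp add: leaf_count_def sum.distrib Int_def)
  also have "card ({..<n} \<inter> e) \<le> 2"
    using card_mono[OF \<open>finite e\<close>, of "{..<n} \<inter> e"] assms by simp
  finally show ?thesis by simp
qed

text \<open>A leaf lies on exactly one drawn edge, whose deletion isolates it. The sum has the form
  to which \<open>draw_exp_delete\<close> applies.\<close>

lemma of_bool_leaf_eq_sum:
  "(of_bool (mdeg F v = 1) :: real) =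
     (\<Sum>e\<in>#F. of_bool (v \<in> e \<and> mdeg (F - {#e#}) v = 0))"
proof -
  have "v \<in> e \<and> mdeg (F - {#e#}) v = 0 \<longleftrightarrow> v \<in> e \<and> mdeg F v = 1" if "e \<in># F" for e
    using mdeg_add[of e "F - {#e#}" v] that by auto
  then have "(\<Sum>e\<in>#F. of_bool (v \<in> e \<and> mdeg (F - {#e#}) v = 0)) =
      (\<Sum>e\<in>#F. of_bool (v \<in> e) * of_bool (mdeg F v = 1) :: real)"
    by (intro arg_cong[of _ _ sum_mset] image_mset_cong) (auto simp: of_bool_def)
  also have "\<dots> = (\<Sum>e\<in>#F. of_bool (v \<in> e)) * of_bool (mdeg F v = 1)"
    by (simp add: sum_mset_distrib_right)
  also have "(\<Sum>e\<in>#F. of_bool (v \<in> e)) = real (mdeg F v)"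
    unfolding mdeg_def by (induction F) auto
  finally show ?thesis by simp
qed

section \<open>Counting the possible edges at, and away from, given vertices\<close>

lemma real_choose_two: "real (n choose 2) = real n * (real n - 1) / 2"
  by (induction n) (simp_all add: numeral_2_eq_2 field_simps)

lemma card_edges_avoiding:
  assumes "U \<subseteq> {..<n}"
  shows "card {e \<in> all_edges n. e \<inter> U = {}} = (n - card U) choose 2"
proof -
  have "{e \<in> all_edges n. e \<inter> U = {}} = {e. e \<subseteq> {..<n} - U \<and> card e = 2}"
    by (auto simp: all_edges_def)
  moreover have "card ({..<n} - U) = n - card U"
    using assms by (simp add: card_Diff_subset finite_subset)
  ultimately show ?thesis
    using n_subsets[of "{..<n} - U" 2] by simp
qed

lemma card_edges_at:
  assumes "v < n"
  shows "real (card {e \<in> all_edges n. v \<in> e}) = real n - 1"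
proof -
  have "card (all_edges n) = card ({e \<in> all_edges n. v \<in> e} \<union> {e \<in> all_edges n. e \<inter> {v} = {}})"
    by (rule arg_cong[of _ _ card]) auto
  also have "\<dots> = card {e \<in> all_edges n. v \<in> e} + card {e \<in> all_edges n. e \<inter> {v} = {}}"
    by (intro card_Un_disjoint) auto
  finally have "card (all_edges n) = card {e \<in> all_edges n. v \<in> e} + card {e \<in> all_edges n. e \<inter> {v} = {}}" .
  then have "real (n choose 2) = real (card {e \<in> all_edges n. v \<in> e}) + real ((n - 1) choose 2)"
    using card_edges_avoiding[of "{v}" n] assms by (simp add: card_all_edges)
  then show ?thesis
    using assms unfolding real_choose_two by (simp add: of_nat_diff field_simps)
qed

text \<open>The factor \<open>\<kappa>\<close> of the overview: \<open>Suc m\<close> choices of the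
  edge regarded as last, \<open>n - 1\<close> edges at an isolated vertex, and the normalisation of
  the last draw.\<close>

definition shift_factor :: "sampling \<Rightarrow> nat \<Rightarrow> nat \<Rightarrow> real" where
  "shift_factor s n m =
     real (Suc m) * (real n - 1) / (real (n choose 2) - depletion s * real m)"

text \<open>Counts pairs of a drawn edge and a leaf on it: deleting the edge isolates the leaf, and
  an isolated vertex can be joined by \<open>n - 1\<close> edges. Allowing \<open>g\<close> to
  differ from \<open>f\<close> covers the second moments, where the weight changes slightly.\<close>

lemma leaf_shift_le:
  assumes m: "m < n choose 2"
    and fg: "\<And>G e v. e \<in> all_edges n \<Longrightarrow> v \<in> e \<Longrightarrow> mdeg G v = 0 \<Longrightarrow> f (add_mset e G) \<le> g G"
  shows "draw_exp s (all_edges n) (Suc m) (\<lambda>F. leaf_count n F * f F)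
    \<le> shift_factor s n m * draw_exp s (all_edges n) m (\<lambda>G. isolated_count n G * g G)"
proof -
  define h where "h G e = (\<Sum>v<n. of_bool (v \<in> e \<and> mdeg G v = 0)) * f (add_mset e G)" for G e
  have eq: "leaf_count n F * f F = (\<Sum>e\<in>#F. h (F - {#e#}) e)" for F
  proof -
    have "leaf_count n F * f F =
        (\<Sum>e\<in>#F. (\<Sum>v<n. of_bool (v \<in> e \<and> mdeg (F - {#e#}) v = 0)) * f F)"
      unfolding leaf_count_def of_bool_leaf_eq_sum
      by (simp add: sum_sum_mset_swap sum_mset_distrib_right)
    also have "\<dots> = (\<Sum>e\<in>#F. h (F - {#e#}) e)"
      by (intro arg_cong[of _ _ sum_mset] image_mset_cong) (simp add: h_def)
    finally show ?thesis .
  qed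
  have le: "(\<Sum>e\<in>all_edges n. urn_weight s G e * h G e) \<le> (real n - 1) * (isolated_count n G * g G)" for G
  proof -
    have "(\<Sum>e\<in>all_edges n. urn_weight s G e * h G e) \<le>
        (\<Sum>e\<in>all_edges n. \<Sum>v<n. of_bool (v \<in> e \<and> mdeg G v = 0) * g G)"
      unfolding h_def sum_distrib_left sum_distrib_right
    proof (intro sum_mono)
      fix e v assume e: "e \<in> all_edges n"
      show "urn_weight s G e * (of_bool (v \<in> e \<and> mdeg G v = 0) * f (add_mset e G))
          \<le> of_bool (v \<in> e \<and> mdeg G v = 0) * g G"
      proof (cases "v \<in> e \<and> mdeg G v = 0")
        case True
        \<comment> \<open>No drawn edge contains \<open>v\<close>, so \<open>e\<close> is still
          available even without replacement.\<close>
        then have "urn_weight s G e = 1"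
          by (auto simp: urn_weight_def mdeg_eq_0_iff)
        then show ?thesis using True fg[OF e, of v G] by simp
      qed auto
    qed
    also have "\<dots> = (\<Sum>v<n. (\<Sum>e\<in>all_edges n. of_bool (v \<in> e)) * of_bool (mdeg G v = 0) * g G)"
      by (subst sum.swap) (simp only: sum_distrib_right of_bool_conj)
    also have "\<dots> = (\<Sum>v<n. (real n - 1) * of_bool (mdeg G v = 0) * g G)"
      using card_edges_at by (intro sum.cong refl) (simp add: Int_def)
    also have "\<dots> = (real n - 1) * (isolated_count n G * g G)"
      by (simp only: isolated_count_def sum_distrib_left sum_distrib_right mult.assoc)
    finally show ?thesis .
  qed
  have "draw_exp s (all_edges n) m (\<lambda>G. \<Sum>e\<in>all_edges n. urn_weight s G e * h G e)
      \<le> (real n - 1) * draw_exp s (all_edges n) m (\<lambda>G. isolated_count n G * g G)"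
    unfolding draw_exp_cmult[symmetric]
    using le m by (intro draw_exp_mono) (auto simp: card_all_edges)
  then have "real (Suc m) / (real (n choose 2) - depletion s * real m)
      * draw_exp s (all_edges n) m (\<lambda>G. \<Sum>e\<in>all_edges n. urn_weight s G e * h G e)
      \<le> real (Suc m) / (real (n choose 2) - depletion s * real m)
      * ((real n - 1) * draw_exp s (all_edges n) m (\<lambda>G. isolated_count n G * g G))"
    using urn_denominator_pos[of m "all_edges n" s] m
    by (intro mult_left_mono) (auto simp: card_all_edges)
  then show ?thesis
    unfolding eq draw_exp_delete[OF finite_all_edges] by (simp add: shift_factor_def card_all_edges)
qed

text \<open>Both directions come from the inequality, applied to \<open>f\<close> and to
  \<open>- f\<close>.\<close>

lemma leaf_shift:
  assumes m: "m < n choose 2"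
    and f: "\<And>G e v. e \<in> all_edges n \<Longrightarrow> v \<in> e \<Longrightarrow> mdeg G v = 0 \<Longrightarrow> f (add_mset e G) = f G"
  shows "draw_exp s (all_edges n) (Suc m) (\<lambda>F. leaf_count n F * f F)
    = shift_factor s n m * draw_exp s (all_edges n) m (\<lambda>G. isolated_count n G * f G)"
proof (rule antisym)
  show "draw_exp s (all_edges n) (Suc m) (\<lambda>F. leaf_count n F * f F)
    \<le> shift_factor s n m * draw_exp s (all_edges n) m (\<lambda>G. isolated_count n G * f G)"
    using f by (intro leaf_shift_le[OF m]) simp
  have "draw_exp s (all_edges n) (Suc m) (\<lambda>F. leaf_count n F * (- f F))
    \<le> shift_factor s n m * draw_exp s (all_edges n) m (\<lambda>G. isolated_count n G * (- f G))"
    using f by (intro leaf_shift_le[OF m]) simp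
  then show "shift_factor s n m * draw_exp s (all_edges n) m (\<lambda>G. isolated_count n G * f G)
    \<le> draw_exp s (all_edges n) (Suc m) (\<lambda>F. leaf_count n F * f F)"
    using draw_exp_cmult[of s "all_edges n" "Suc m" "-1" "\<lambda>F. leaf_count n F * f F"]
      draw_exp_cmult[of s "all_edges n" m "-1" "\<lambda>F. isolated_count n F * f F"] by simp
qed

subsection \<open>Second moments\<close>

text \<open>The probability that a given vertex is still isolated after \<open>m\<close> draws; see
  \<open>draw_exp_untouched_vertex\<close>.\<close>

definition avoid_prob :: "sampling \<Rightarrow> nat \<Rightarrow> nat \<Rightarrow> real" where
  "avoid_prob s n m = (\<Prod>j<m. (real ((n - 1) choose 2) - depletion s * real j)
     / (real (n choose 2) - depletion s * real j))"

text \<open>The conditional probability that the next edge meets a vertex isolated so far.\<close>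

definition hit_rate :: "sampling \<Rightarrow> nat \<Rightarrow> nat \<Rightarrow> real" where
  "hit_rate s n m = (real n - 1) / (real (n choose 2) - depletion s * real m)"

lemma shift_factor_eq: "shift_factor s n m = real (Suc m) * hit_rate s n m"
  by (simp add: shift_factor_def hit_rate_def)

lemma hit_rate_bounds:
  assumes "2 \<le> n" "2 * m \<le> n choose 2"
  shows "2 / real n \<le> hit_rate s n m" "hit_rate s n m \<le> 4 / real n"
proof -
  define D where "D = real (n choose 2) - depletion s * real m"
  have n: "0 < real n" "0 < real n - 1" using assms(1) by auto
  have m: "2 * real m \<le> real (n choose 2)"
    using assms(2) by (metis of_nat_le_iff of_nat_mult of_nat_numeral)
  then have D: "real n * (real n - 1) / 4 \<le> D" "D \<le> real n * (real n - 1) / 2"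
    using depletion_cases[of s] unfolding D_def real_choose_two by auto
  have "0 < real n * (real n - 1) / 4" using n by simp
  then have "0 < D" using D by linarith
  then show "2 / real n \<le> hit_rate s n m" "hit_rate s n m \<le> 4 / real n"
    using D n unfolding hit_rate_def D_def[symmetric]
    by (simp_all add: field_simps)
qed

lemma avoid_prob_Suc:
  assumes "2 \<le> n" "2 * m \<le> n choose 2"
  shows "avoid_prob s n (Suc m) = avoid_prob s n m * (1 - hit_rate s n m)"
proof -
  have "0 < n choose 2" using assms(1) by simp
  then have "m < n choose 2" using assms(2) by linarith
  then have "0 < real (n choose 2) - depletion s * real m"
    using urn_denominator_pos[of m "all_edges n" s] by (simp add: card_all_edges)
  moreover have "real ((n - 1) choose 2) = real (n choose 2) - (real n - 1)"
    using assms(1) unfolding real_choose_two by (simp add: of_nat_diff field_simps)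
  ultimately have "(real ((n - 1) choose 2) - depletion s * real m)
      / (real (n choose 2) - depletion s * real m) = 1 - hit_rate s n m"
    by (simp add: hit_rate_def divide_simps)
  then show ?thesis by (simp add: avoid_prob_def)
qed

lemma avoid_prob_0 [simp]: "avoid_prob s n 0 = 1"
  by (simp add: avoid_prob_def)

text \<open>The exponential bound keeps the expected number of isolated vertices linear in
  \<open>n\<close> while \<open>m = O(n)\<close>. The linear bound controls
  \<open>1 - avoid_prob s n m\<close> in the second moment of \<open>leaf_count\<close>.\<close>

lemma avoid_prob_bounds:
  assumes "8 \<le> n" "2 * m \<le> n choose 2"
  shows "exp (- 8 * real m / real n) \<le> avoid_prob s n m" "avoid_prob s n m \<le> 1"
    "1 - 4 * real m / real n \<le> avoid_prob s n m"
proof -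
  have "exp (- 8 * real m / real n) \<le> avoid_prob s n m \<and> avoid_prob s n m \<le> 1 \<and>
    1 - 4 * real m / real n \<le> avoid_prob s n m"
    using assms(2)
  proof (induction m)
    case (Suc m)
    define x where "x = hit_rate s n m"
    define A where "A = avoid_prob s n m"
    have n: "real n \<ge> 8" using assms(1) by simp
    have "2 / real n \<le> x" "x \<le> 4 / real n"
      using hit_rate_bounds[of n m s] Suc.prems assms(1) by (auto simp: x_def)
    moreover have "0 \<le> 2 / real n" "4 / real n \<le> 1 / 2"
      using n by (auto simp: field_simps)
    ultimately have x: "0 \<le> x" "x \<le> 4 / real n" "x \<le> 1 / 2" by linarith+
    have IH: "exp (- 8 * real m / real n) \<le> A" "A \<le> 1" "1 - 4 * real m / real n \<le> A"
      using Suc by (auto simp: A_def)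
    have A0: "0 \<le> A" using IH(1) by (rule order_trans[rotated]) simp
    have eq: "avoid_prob s n (Suc m) = A * (1 - x)"
      using avoid_prob_Suc[of n m s] Suc.prems assms(1) by (simp add: A_def x_def)
    \<comment> \<open>For \<open>0 \<le> x \<le> 1/2\<close> one has
      \<open>exp (- 2 * x) \<le> 1 / (1 + 2 * x) \<le> 1 - x\<close>; \<open>8 \<le> n\<close>
      ensures \<open>4 / n \<le> 1/2\<close>.\<close>
    have "exp (- 8 / real n) \<le> exp (- (2 * x))"
      using x(2) by simp
    also have "\<dots> \<le> 1 / (1 + 2 * x)"
      using exp_ge_add_one_self[of "2 * x"] x(1) by (simp add: exp_minus field_simps)
    also have "\<dots> \<le> 1 - x"
    proof -
      have "0 \<le> x * (1 - 2 * x)" using x by simp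
      then show ?thesis using x(1) by (simp add: field_simps)
    qed
    finally have e: "exp (- 8 / real n) \<le> 1 - x" .
    have "exp (- 8 * real (Suc m) / real n) = exp (- 8 * real m / real n) * exp (- 8 / real n)"
      by (simp add: exp_add[symmetric] add_divide_distrib[symmetric] algebra_simps)
    also have "\<dots> \<le> A * (1 - x)"
      using IH(1) e A0 by (intro mult_mono) auto
    finally have 1: "exp (- 8 * real (Suc m) / real n) \<le> A * (1 - x)" .
    have 2: "A * (1 - x) \<le> 1" using IH(2) A0 x by (intro mult_le_one) auto
    have "A * x \<le> 1 * (4 / real n)" using IH(2) A0 x by (intro mult_mono) auto
    then have 3: "1 - 4 * real (Suc m) / real n \<le> A * (1 - x)"
      using IH(3) by (simp add: algebra_simps add_divide_distrib)
    show ?case unfolding eq using 1 2 3 by blast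
  qed auto
  then show "exp (- 8 * real m / real n) \<le> avoid_prob s n m" "avoid_prob s n m \<le> 1"
    "1 - 4 * real m / real n \<le> avoid_prob s n m" by auto
qed

section \<open>Moments of the number of isolated vertices\<close>

lemma draw_exp_untouched:
  assumes "U \<subseteq> {..<n}"
  shows "draw_exp s (all_edges n) m (\<lambda>F. of_bool (\<forall>v\<in>U. mdeg F v = 0)) =
    (\<Prod>j<m. (real ((n - card U) choose 2) - depletion s * real j)
      / (real (n choose 2) - depletion s * real j))"
proof -
  have "draw_exp s (all_edges n) m (\<lambda>F. of_bool (\<forall>v\<in>U. mdeg F v = 0)) =
      draw_exp s (all_edges n) m (\<lambda>F. of_bool (set_mset F \<subseteq> {e \<in> all_edges n. e \<inter> U = {}}))"
    by (intro draw_exp_cong arg_cong[of _ _ of_bool]) (auto simp: drawable_def mdeg_eq_0_iff)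
  also have "\<dots> = (\<Prod>j<m. (real ((n - card U) choose 2) - depletion s * real j)
      / (real (n choose 2) - depletion s * real j))"
    by (subst draw_exp_subset) (auto simp: card_edges_avoiding[OF assms] card_all_edges)
  finally show ?thesis .
qed

lemma draw_exp_untouched_vertex:
  "v < n \<Longrightarrow> draw_exp s (all_edges n) m (\<lambda>F. of_bool (mdeg F v = 0)) = avoid_prob s n m"
  using draw_exp_untouched[of "{v}" n s m] by (simp add: avoid_prob_def)

lemma draw_exp_isolated:
  "draw_exp s (all_edges n) m (isolated_count n) = real n * avoid_prob s n m"
proof -
  have "draw_exp s (all_edges n) m (isolated_count n) =
      (\<Sum>v<n. draw_exp s (all_edges n) m (\<lambda>F. of_bool (mdeg F v = 0)))"
    unfolding isolated_count_def[abs_def] by (rule draw_exp_sum) simp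
  then show ?thesis by (simp add: draw_exp_untouched_vertex)
qed

text \<open>Isolation of two vertices is negatively correlated, factor by factor in the products.
  The bound on \<open>m\<close> keeps all factors nonnegative.\<close>

lemma draw_exp_untouched_pair:
  assumes n: "8 \<le> n" "2 * m \<le> (n - 2) choose 2" and uv: "u < n" "v < n" "u \<noteq> v"
  shows "draw_exp s (all_edges n) m (\<lambda>F. of_bool (mdeg F u = 0 \<and> mdeg F v = 0))
    \<le> (avoid_prob s n m)\<^sup>2"
proof -
  have "draw_exp s (all_edges n) m (\<lambda>F. of_bool (mdeg F u = 0 \<and> mdeg F v = 0)) =
      (\<Prod>j<m. (real ((n - 2) choose 2) - depletion s * real j)
        / (real (n choose 2) - depletion s * real j))"
  proof -
    have c: "card {u, v} = 2" using uv by simp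
    show ?thesis using draw_exp_untouched[of "{u, v}" n s m, unfolded c] uv by simp
  qed
  also have "\<dots> \<le> (\<Prod>j<m. ((real ((n - 1) choose 2) - depletion s * real j)
     / (real (n choose 2) - depletion s * real j))\<^sup>2)"
  proof (intro prod_mono conjI)
    fix j assume "j \<in> {..<m}"
    then have j: "2 * real j \<le> real ((n - 2) choose 2)" using n(2) by simp
    define x where "x = depletion s * real j"
    define N where "N = real (n choose 2)"
    have N: "N = real n * (real n - 1) / 2" "real ((n - 1) choose 2) = N - (real n - 1)"
      "real ((n - 2) choose 2) = N - (2 * real n - 3)"
      using n unfolding N_def real_choose_two by (simp_all add: of_nat_diff field_simps)
    have x: "0 \<le> x" "x \<le> real j"
      using depletion_cases[of s] by (auto simp: x_def)
    have D: "0 < N - x" "0 \<le> N - (2 * real n - 3) - x"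
      using j x n(1) unfolding N(3) by linarith+
    show "0 \<le> (real ((n - 2) choose 2) - depletion s * real j)
        / (real (n choose 2) - depletion s * real j)"
      using D unfolding N(3) x_def[symmetric] N_def[symmetric] by simp
    \<comment> \<open>The difference of the two sides below is
      \<open>(n - 1)^2 - N + x\<close>.\<close>
    have "N \<le> (real n - 1)\<^sup>2"
      unfolding N(1) using n(1) by (simp add: power2_eq_square)
    then have "(N - (2 * real n - 3) - x) * (N - x) \<le> (N - (real n - 1) - x)\<^sup>2"
      using x(1) by (simp add: power2_eq_square algebra_simps)
    then show "(real ((n - 2) choose 2) - depletion s * real j)
        / (real (n choose 2) - depletion s * real j)
        \<le> ((real ((n - 1) choose 2) - depletion s * real j)
          / (real (n choose 2) - depletion s * real j))\<^sup>2"
      using D unfolding N(2,3) x_def[symmetric] N_def[symmetric]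
      by (simp add: power_divide divide_simps power2_eq_square)
  qed
  finally show ?thesis by (simp add: avoid_prob_def prod_power_distrib)
qed

text \<open>The variance is at most the mean: the diagonal contributes the mean, and distinct pairs
  at most its square.\<close>

lemma draw_exp_isolated_sq:
  assumes "8 \<le> n" "2 * m \<le> (n - 2) choose 2"
  shows "draw_exp s (all_edges n) m (\<lambda>F. isolated_count n F * isolated_count n F)
    \<le> real n * avoid_prob s n m + (real n * avoid_prob s n m)\<^sup>2"
proof -
  have "draw_exp s (all_edges n) m (\<lambda>F. isolated_count n F * isolated_count n F) =
      (\<Sum>u<n. \<Sum>v<n. draw_exp s (all_edges n) m (\<lambda>F. of_bool (mdeg F u = 0 \<and> mdeg F v = 0)))"
    unfolding isolated_count_def sum_product of_bool_conj[symmetric]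
    by (simp only: draw_exp_sum finite_lessThan)
  also have "\<dots> \<le> (\<Sum>u<n. \<Sum>v<n. of_bool (u = v) * avoid_prob s n m + (avoid_prob s n m)\<^sup>2)"
  proof (intro sum_mono)
    fix u v assume "u \<in> {..<n}" "v \<in> {..<n}"
    then show "draw_exp s (all_edges n) m (\<lambda>F. of_bool (mdeg F u = 0 \<and> mdeg F v = 0))
        \<le> of_bool (u = v) * avoid_prob s n m + (avoid_prob s n m)\<^sup>2"
      using draw_exp_untouched_pair[OF assms, of u v s] draw_exp_untouched_vertex[of u n s m]
      by (cases "u = v") auto
  qed
  also have "\<dots> = real n * avoid_prob s n m + (real n * avoid_prob s n m)\<^sup>2"
    by (simp add: sum.distrib power2_eq_square algebra_simps flip: sum_distrib_right)
  finally show ?thesis .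
qed

section \<open>Moments of the number of leaves\<close>

lemma choose_two_diff_le: "(n - 2) choose 2 \<le> n choose 2"
  by (intro binomial_right_mono) simp

lemma draw_exp_leaf:
  assumes "8 \<le> n" "2 * m \<le> n choose 2"
  shows "draw_exp s (all_edges n) (Suc m) (leaf_count n) =
    shift_factor s n m * (real n * avoid_prob s n m)"
proof -
  have "0 < n choose 2" using assms(1) by simp
  then have "m < n choose 2" using assms(2) by linarith
  then show ?thesis
    using leaf_shift[of m n "\<lambda>_. 1" s] draw_exp_isolated[of s n m] by simp
qed

text \<open>Shifting twice turns two leaf factors into two isolated-vertex factors. The error must
  be of order \<open>m\<close> rather than \<open>n\<close>, since \<open>shift_factor\<close> is
  only of order \<open>(m + 1) / n\<close> and the bound is compared with the squared mean.\<close>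

lemma draw_exp_leaf_sq:
  assumes n: "8 \<le> n" and m: "2 * m \<le> (n - 2) choose 2"
  shows "draw_exp s (all_edges n) (Suc m) (\<lambda>F. leaf_count n F * leaf_count n F)
    \<le> (shift_factor s n m * (real n * avoid_prob s n m))\<^sup>2 + shift_factor s n m * (44 * real m)"
proof -
  let ?E = "draw_exp s (all_edges n)"
  define K where "K = shift_factor s n m"
  define A where "A = avoid_prob s n m"
  have m2: "2 * m \<le> n choose 2" using m choose_two_diff_le order_trans by blast
  have "0 < n choose 2" using n by simp
  then have mN: "m < n choose 2" using m2 by linarith
  have hr: "2 / real n \<le> hit_rate s n m" "hit_rate s n m \<le> 4 / real n"
    using hit_rate_bounds[of n m s] n m2 by auto
  have "real (Suc m) * (2 / real n) \<le> K"
    unfolding K_def shift_factor_eq using hr by (intro mult_left_mono) auto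
  then have K: "2 * real (Suc m) / real n \<le> K" by (simp add: mult.commute)
  have "0 \<le> 2 * real (Suc m) / real n" by simp
  then have K0: "0 \<le> K" using K by linarith
  have A: "0 \<le> A" "A \<le> 1" "1 - 4 * real m / real n \<le> A"
    using avoid_prob_bounds[OF n m2, of s] order_trans[OF exp_ge_zero] by (auto simp: A_def)
  have "?E (Suc m) (\<lambda>F. leaf_count n F * leaf_count n F)
      \<le> K * ?E m (\<lambda>G. isolated_count n G * (leaf_count n G + 2))"
    unfolding K_def by (intro leaf_shift_le mN leaf_count_add) (auto simp: all_edges_def)
  also have "?E m (\<lambda>G. isolated_count n G * (leaf_count n G + 2)) =
      ?E m (\<lambda>G. leaf_count n G * isolated_count n G) + 2 * (real n * A)"
    using draw_exp_linear[of s "all_edges n" m 1 "\<lambda>G. leaf_count n G * isolated_count n G"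
        2 "isolated_count n"] draw_exp_isolated[of s n m]
    by (simp add: A_def algebra_simps)
  \<comment> \<open>The term \<open>2 * n * A\<close> is not of order \<open>m\<close>. It is
    absorbed by the increase from \<open>L\<close> to \<open>K\<close>, up to
    \<open>2 * n * A * (1 - A) \<le> 8 * m\<close>; the remaining \<open>36 * m\<close> comes from
    the second shift.\<close>
  also have "?E m (\<lambda>G. leaf_count n G * isolated_count n G) + 2 * (real n * A)
      \<le> 44 * real m + K * (real n * A)\<^sup>2"
  proof (cases m)
    case 0
    have "K * (real n * A)\<^sup>2 = 2 * real n"
    proof -
      have "K = 2 / real n"
        unfolding K_def 0 shift_factor_def real_choose_two using n by (simp add: field_simps)
      then show ?thesis using n by (simp add: A_def 0 power2_eq_square)
    qed
    then show ?thesis by (simp add: 0 leaf_count_def mdeg_def A_def)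
  next
    case (Suc k)
    define B where "B = avoid_prob s n k"
    define L where "L = shift_factor s n k"
    have k: "2 * k \<le> n choose 2" "2 * k \<le> (n - 2) choose 2" "k < n choose 2"
      using m2 m mN Suc by auto
    have hk: "hit_rate s n k \<le> 4 / real n" "2 / real n \<le> hit_rate s n k"
      using hit_rate_bounds[of n k s] n k by auto
    have L0: "0 \<le> L" unfolding L_def shift_factor_eq
      using order_trans[OF _ hk(2), of 0] by simp
    have L4: "L \<le> 4 * real m / real n"
    proof -
      have "L \<le> real (Suc k) * (4 / real n)"
        unfolding L_def shift_factor_eq using hk by (intro mult_left_mono) auto
      then show ?thesis by (simp add: Suc mult.commute)
    qed
    have "hit_rate s n k \<le> hit_rate s n m"
      unfolding hit_rate_def using n Suc depletion_cases[of s]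
        urn_denominator_pos[of m "all_edges n" s] mN
      by (intro divide_left_mono mult_pos_pos) (auto simp: card_all_edges)
    \<comment> \<open>One draw raises the shift factor by at least one hit rate, hence by
      \<open>2 / n\<close>.\<close>
    then have "L \<le> real m * hit_rate s n m"
      unfolding L_def shift_factor_eq Suc by (intro mult_left_mono) auto
    also have "\<dots> = K - hit_rate s n m"
      by (simp add: K_def shift_factor_eq algebra_simps)
    finally have LK: "L - K \<le> - (2 / real n)" using hr(1) by linarith
    have B: "0 \<le> B" "B \<le> 1"
      using avoid_prob_bounds[OF n k(1), of s] order_trans[OF exp_ge_zero] by (auto simp: B_def)
    have AB: "A = B * (1 - hit_rate s n k)"
      using avoid_prob_Suc[of n k s] n k by (simp add: A_def B_def Suc)
    have "B * hit_rate s n k \<le> 1 * (4 / real n)"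
      using B hk order_trans[OF _ hk(2), of 0] by (intro mult_mono) auto
    then have d: "B - A \<le> 4 / real n" by (simp add: AB algebra_simps)
    have sq: "B\<^sup>2 - A\<^sup>2 \<le> 8 / real n"
    proof -
      have "B\<^sup>2 - A\<^sup>2 = (B - A) * (B + A)" by (simp add: power2_eq_square algebra_simps)
      also have "\<dots> \<le> (4 / real n) * 2"
        using d A B by (intro mult_mono) auto
      finally show ?thesis by simp
    qed
    have "?E m (\<lambda>G. leaf_count n G * isolated_count n G)
        \<le> L * ?E k (\<lambda>G. isolated_count n G * isolated_count n G)"
      unfolding Suc L_def by (intro leaf_shift_le k isolated_count_add)
    also have "\<dots> \<le> L * (real n * B + (real n * B)\<^sup>2)"
      using draw_exp_isolated_sq[OF n k(2), of s] L0 by (intro mult_left_mono) (auto simp: B_def)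
    \<comment> \<open>Replaces \<open>B\<close> by \<open>A\<close> in the main term; since
      \<open>B\<^sup>2 - A\<^sup>2 \<le> 8 / n\<close>, the correction is at most
      \<open>L * 9 * n\<close>.\<close>
    also have "\<dots> = L * (real n * B + (real n)\<^sup>2 * (B\<^sup>2 - A\<^sup>2)) + L * (real n * A)\<^sup>2"
      by (simp add: algebra_simps power_mult_distrib)
    also have "L * (real n * B + (real n)\<^sup>2 * (B\<^sup>2 - A\<^sup>2)) \<le> L * (9 * real n)"
    proof (intro mult_left_mono L0)
      have "(real n)\<^sup>2 * (B\<^sup>2 - A\<^sup>2) \<le> (real n)\<^sup>2 * (8 / real n)"
        using sq by (intro mult_left_mono) auto
      also have "\<dots> = 8 * real n" using n by (simp add: power2_eq_square)
      finally show "real n * B + (real n)\<^sup>2 * (B\<^sup>2 - A\<^sup>2) \<le> 9 * real n"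
        using mult_left_mono[OF B(2), of "real n"] by simp
    qed
    also have "L * (9 * real n) \<le> (4 * real m / real n) * (9 * real n)"
      using L4 by (intro mult_right_mono) auto
    also have "\<dots> = 36 * real m" using n by simp
    finally have 1: "?E m (\<lambda>G. leaf_count n G * isolated_count n G)
        \<le> 36 * real m + L * (real n * A)\<^sup>2" by simp
    have "(L - K) * (real n * A)\<^sup>2 \<le> - (2 / real n) * (real n * A)\<^sup>2"
      using LK by (intro mult_right_mono) auto
    also have "\<dots> = - (2 * real n * A * A)"
      using n by (simp add: power2_eq_square)
    finally have 2: "L * (real n * A)\<^sup>2 \<le> K * (real n * A)\<^sup>2 - 2 * real n * A * A"
      by (simp add: algebra_simps)
    have "2 * real n * A * (1 - A) \<le> 2 * real n * 1 * (4 * real m / real n)"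
      using A by (intro mult_mono) auto
    also have "\<dots> = 8 * real m" using n by simp
    finally have 3: "2 * (real n * A) - 2 * real n * A * A \<le> 8 * real m"
      by (simp add: algebra_simps)
    show ?thesis using 1 2 3 by linarith
  qed
  finally have "?E (Suc m) (\<lambda>F. leaf_count n F * leaf_count n F)
      \<le> K * (44 * real m + K * (real n * A)\<^sup>2)"
    using K0 by (simp add: mult_left_mono)
  then show ?thesis
    by (simp add: K_def A_def power_mult_distrib power2_eq_square algebra_simps)
qed

subsection \<open>The effect of a single edge\<close>

text \<open>With \<open>z = 1 - Y / \<mu>\<close> the second moment of \<open>z\<close> is at most
  \<open>t\<^sup>2\<close>. The pointwise bound
  \<open>\<bar>z\<bar> \<le> (t + z\<^sup>2 / t) / 2\<close> is quadratic in \<open>Y\<close>, so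
  linearity of \<open>draw_exp\<close> takes the place of Cauchy-Schwarz.\<close>

lemma draw_exp_reweight_le:
  assumes E: "finite E" "m \<le> card E" and t: "0 < t" and \<mu>: "0 < \<mu>"
    and Y: "draw_exp s E m Y = \<mu>" "draw_exp s E m (\<lambda>F. Y F * Y F) \<le> \<mu>\<^sup>2 * (1 + t\<^sup>2)"
    and f: "\<And>F. \<bar>f F\<bar> \<le> 1"
  shows "draw_exp s E m f - draw_exp s E m (\<lambda>F. Y F * f F) / \<mu> \<le> t"
proof -
  have "draw_exp s E m f - draw_exp s E m (\<lambda>F. Y F * f F) / \<mu> =
      draw_exp s E m (\<lambda>F. f F - Y F * f F / \<mu>)"
    by (simp only: draw_exp_diff draw_exp_divide)
  also have "\<dots> \<le> draw_exp s E m (\<lambda>F. (t + 1 / t) / 2 + (- 1 / (t * \<mu>) * Y F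
      + 1 / (2 * t * \<mu>\<^sup>2) * (Y F * Y F)))"
  proof (intro draw_exp_mono E(2))
    fix F
    define z where "z = 1 - Y F / \<mu>"
    have "f F - Y F * f F / \<mu> = f F * z" by (simp add: z_def algebra_simps)
    also have "\<dots> \<le> \<bar>f F\<bar> * \<bar>z\<bar>" by (metis abs_ge_self abs_mult)
    also have "\<dots> \<le> \<bar>z\<bar>" using mult_right_mono[OF f[of F], of "\<bar>z\<bar>"] by simp
    also have "\<bar>z\<bar> \<le> (t + z\<^sup>2 / t) / 2"
    proof -
      have "0 \<le> (t - \<bar>z\<bar>)\<^sup>2" by simp
      then have "2 * t * \<bar>z\<bar> \<le> t\<^sup>2 + z\<^sup>2" by (simp add: power2_diff)
      then show ?thesis using t by (simp add: field_simps power2_eq_square)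
    qed
    also have "\<dots> = (t + 1 / t) / 2 + (- 1 / (t * \<mu>) * Y F + 1 / (2 * t * \<mu>\<^sup>2) * (Y F * Y F))"
      using t \<mu> by (simp add: z_def field_simps power2_eq_square)
    finally show "f F - Y F * f F / \<mu> \<le> \<dots>" .
  qed
  also have "\<dots> = (t + 1 / t) / 2 + (- 1 / (t * \<mu>) * \<mu>
      + 1 / (2 * t * \<mu>\<^sup>2) * draw_exp s E m (\<lambda>F. Y F * Y F))"
    by (simp only: draw_exp_add draw_exp_cmult draw_exp_const[OF E] Y(1))
  also have "\<dots> \<le> (t + 1 / t) / 2 + (- 1 / (t * \<mu>) * \<mu>
      + 1 / (2 * t * \<mu>\<^sup>2) * (\<mu>\<^sup>2 * (1 + t\<^sup>2)))"
    using Y(2) t by (intro add_left_mono mult_left_mono) auto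
  also have "\<dots> = t"
    using t \<mu> by (simp add: field_simps power2_eq_square)
  finally show ?thesis .
qed

lemma draw_exp_reweight:
  assumes "finite E" "m \<le> card E" "0 < t" "0 < \<mu>"
    and "draw_exp s E m Y = \<mu>" "draw_exp s E m (\<lambda>F. Y F * Y F) \<le> \<mu>\<^sup>2 * (1 + t\<^sup>2)"
    and "\<And>F. \<bar>f F\<bar> \<le> 1"
  shows "\<bar>draw_exp s E m f - draw_exp s E m (\<lambda>F. Y F * f F) / \<mu>\<bar> \<le> t"
proof -
  have "draw_exp s E m (\<lambda>F. - f F) = - draw_exp s E m f"
    "draw_exp s E m (\<lambda>F. Y F * - f F) = - draw_exp s E m (\<lambda>F. Y F * f F)"
    using draw_exp_cmult[of s E m "-1" f] draw_exp_cmult[of s E m "-1" "\<lambda>F. Y F * f F"] by simp_all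
  then show ?thesis
    using draw_exp_reweight_le[OF assms(1-6), of f] draw_exp_reweight_le[OF assms(1-6), of "\<lambda>F. - f F"]
      assms(7)
    by (simp add: abs_le_iff)
qed

lemma core_prob_step:
  assumes n: "8 \<le> n" and m: "2 * m \<le> (n - 2) choose 2" and q: "2 \<le> q"
  shows "\<bar>core_prob s q n (Suc m) - core_prob s q n m\<bar> \<le> 6 / (avoid_prob s n m * sqrt (real n))"
proof -
  let ?E = "all_edges n"
  define f where "f F = (of_bool (has_core q ({..<n}, set_mset F)) :: real)" for F
  define A where "A = avoid_prob s n m"
  define K where "K = shift_factor s n m"
  define \<mu> where "\<mu> = K * (real n * A)"
  \<comment> \<open>Bounds the relative standard deviation of \<open>isolated_count\<close>, whose
    relative variance is at most \<open>1 / (n * A) \<le> t\<^sup>2\<close>.\<close>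
  define t where "t = 1 / (A * sqrt (real n))"
  have m2: "2 * m \<le> n choose 2" using m choose_two_diff_le order_trans by blast
  have pos: "0 < n choose 2" using n by simp
  then have mN: "m < n choose 2" using m2 by linarith
  have A: "0 < A" "A \<le> 1"
    using avoid_prob_bounds[OF n m2, of s] less_le_trans[OF exp_gt_zero] by (auto simp: A_def)
  have "2 / real n \<le> hit_rate s n m" using hit_rate_bounds[of n m s] n m2 by auto
  then have "real (Suc m) * (2 / real n) \<le> K"
    unfolding K_def shift_factor_eq by (intro mult_left_mono) auto
  moreover have "0 < real (Suc m) * (2 / real n)" using n by simp
  ultimately have "0 < K" "real (Suc m) * (2 / real n) \<le> K" by linarith+
  then have K: "2 * real m \<le> K * real n" "0 < K"
    using n by (simp_all add: field_simps)
  have \<mu>: "0 < \<mu>" using K A n by (simp add: \<mu>_def)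
  have t: "0 < t" using A n by (simp add: t_def)
  have nA: "real n * A * (A * t\<^sup>2) = 1"
    using A n by (simp add: t_def power_divide power_mult_distrib power2_eq_square field_simps)
  have fb: "\<bar>f F\<bar> \<le> 1" for F by (simp add: f_def)
  have finv: "f (add_mset e G) = f G" if "e \<in> ?E" "v \<in> e" "mdeg G v = 0" for G e v
    using has_core_insert_pendant[of "{..<n}" q v e "set_mset G"] that q
    by (simp add: f_def mdeg_eq_0_iff)
  have shift: "draw_exp s ?E (Suc m) (\<lambda>F. leaf_count n F * f F) =
      K * draw_exp s ?E m (\<lambda>F. isolated_count n F * f F)"
    unfolding K_def using leaf_shift[OF mN finv] .
  have 1: "\<bar>draw_exp s ?E (Suc m) f
      - draw_exp s ?E (Suc m) (\<lambda>F. leaf_count n F * f F) / \<mu>\<bar> \<le> 5 * t"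
  proof (rule draw_exp_reweight[OF finite_all_edges _ _ \<mu> _ _ fb])
    show "Suc m \<le> card ?E" "0 < 5 * t" using mN t by (auto simp: card_all_edges)
    show "draw_exp s ?E (Suc m) (leaf_count n) = \<mu>"
      using draw_exp_leaf[OF n m2, of s] by (simp add: \<mu>_def K_def A_def)
    \<comment> \<open>Here \<open>\<mu>\<^sup>2 * t\<^sup>2 = K\<^sup>2 * n\<close> and
      \<open>2 * m \<le> K * n\<close>, so \<open>25\<close> suffices; hence \<open>5 * t\<close>
      for the leaves and \<open>6 * t\<close> in total.\<close>
    have "K * (44 * real m) \<le> \<mu>\<^sup>2 * (25 * t\<^sup>2)"
    proof -
      have "44 * real m \<le> 25 * (2 * real m)" by simp
      also have "\<dots> \<le> 25 * (K * real n)" using K by simp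
      also have "\<dots> = 25 * (K * real n) * (real n * A * (A * t\<^sup>2))" unfolding nA by simp
      finally have "K * (44 * real m) \<le> K * (25 * (K * real n) * (real n * A * (A * t\<^sup>2)))"
        using K(2) by (intro mult_left_mono) auto
      then show ?thesis by (simp add: \<mu>_def power2_eq_square mult_ac)
    qed
    then show "draw_exp s ?E (Suc m) (\<lambda>F. leaf_count n F * leaf_count n F)
        \<le> \<mu>\<^sup>2 * (1 + (5 * t)\<^sup>2)"
      using draw_exp_leaf_sq[OF n m, of s]
      by (simp add: \<mu>_def K_def A_def power_mult_distrib distrib_left)
  qed
  have 2: "\<bar>draw_exp s ?E m f
      - draw_exp s ?E m (\<lambda>F. isolated_count n F * f F) / (real n * A)\<bar> \<le> t"
  proof (rule draw_exp_reweight[OF finite_all_edges _ t _ _ _ fb])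
    show "m \<le> card ?E" "0 < real n * A" using mN A n by (auto simp: card_all_edges)
    show "draw_exp s ?E m (isolated_count n) = real n * A"
      by (simp add: draw_exp_isolated A_def)
    have "real n * A \<le> real n * (real n * A * (A * t\<^sup>2))"
      unfolding nA using A by (intro mult_left_mono) auto
    then have "real n * A \<le> (real n * A)\<^sup>2 * t\<^sup>2"
      by (simp add: power2_eq_square mult_ac)
    then show "draw_exp s ?E m (\<lambda>F. isolated_count n F * isolated_count n F)
        \<le> (real n * A)\<^sup>2 * (1 + t\<^sup>2)"
      using draw_exp_isolated_sq[OF n m, of s] by (simp add: A_def distrib_left)
  qed
  \<comment> \<open>The two reweighted averages coincide, so only the two reweighting errors
    remain.\<close>
  have "draw_exp s ?E (Suc m) (\<lambda>F. leaf_count n F * f F) / \<mu> =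
      draw_exp s ?E m (\<lambda>F. isolated_count n F * f F) / (real n * A)"
    unfolding shift \<mu>_def using K(2) by simp
  then have "\<bar>draw_exp s ?E (Suc m) f - draw_exp s ?E m f\<bar> \<le> 6 * t"
    using 1 2 by linarith
  moreover have "core_prob s q n (Suc m) = draw_exp s ?E (Suc m) f"
    "core_prob s q n m = draw_exp s ?E m f"
    using mN pos unfolding f_def by (simp_all add: core_prob_draw_exp)
  ultimately show ?thesis by (simp add: t_def A_def)
qed

text \<open>Telescopes \<open>core_prob_step\<close>; up to \<open>C * n\<close> edges,
  \<open>avoid_prob\<close> is at least \<open>exp (- 8 * C)\<close>.\<close>

lemma core_prob_diff_le:
  assumes n: "8 \<le> n" and M: "2 * M \<le> (n - 2) choose 2" "real M \<le> C * real n" and q: "2 \<le> q"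
    and ij: "i \<le> j" "j \<le> M"
  shows "core_prob s q n j - core_prob s q n i
    \<le> real (j - i) * (6 * exp (8 * C) / sqrt (real n))"
  using ij
proof (induction j rule: dec_induct)
  case (step m)
  have m: "2 * m \<le> (n - 2) choose 2" using M(1) step by linarith
  then have m2: "2 * m \<le> n choose 2" using choose_two_diff_le order_trans by blast
  have "real m \<le> C * real n" using M(2) step by simp
  then have "8 * real m / real n \<le> 8 * C" using n by (simp add: field_simps)
  then have "exp (- (8 * C)) \<le> exp (- 8 * real m / real n)" by simp
  also have "\<dots> \<le> avoid_prob s n m" by (rule avoid_prob_bounds(1)[OF n m2])
  finally have "6 / (avoid_prob s n m * sqrt (real n)) \<le> 6 / (exp (- (8 * C)) * sqrt (real n))"
    using n by (intro divide_left_mono mult_right_mono mult_pos_pos)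
      (auto intro: less_le_trans[OF exp_gt_zero])
  also have "\<dots> = 6 * exp (8 * C) / sqrt (real n)" by (simp add: exp_minus field_simps)
  finally have "core_prob s q n (Suc m) - core_prob s q n m \<le> 6 * exp (8 * C) / sqrt (real n)"
    using core_prob_step[OF n m q, of s] by linarith
  moreover have "real (Suc m - i) = real (m - i) + 1"
    using step.hyps by (simp add: Suc_diff_le)
  moreover have "core_prob s q n m - core_prob s q n i
      \<le> real (m - i) * (6 * exp (8 * C) / sqrt (real n))"
    using step by simp
  ultimately show ?case
    by (simp only: distrib_right mult_1_left)
qed simp

subsection \<open>Existence of a core for linearly many edges\<close>

lemma size_ge_card_set_mset: "card (set_mset F) \<le> size F"
  by (induction F) (auto simp: card_insert_if)

text \<open>After \<open>m\<close> draws the next one repeats an edge with probability at most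
  \<open>m / card E\<close>; without replacement it never does.\<close>

lemma draw_exp_repetitions:
  assumes "finite E" "m \<le> card E"
  shows "draw_exp s E m (\<lambda>F. real (size F) - real (card (set_mset F))) \<le> (real m)\<^sup>2 / real (card E)"
  using assms(2)
proof (induction m)
  case (Suc m)
  define g where "g F = real (size F) - real (card (set_mset F))" for F :: "'a multiset"
  define D where "D = real (card E) - depletion s * real m"
  have D: "0 < D" unfolding D_def using Suc.prems by (intro urn_denominator_pos) simp
  have "(\<Sum>e\<in>E. urn_weight s F e * g (add_mset e F)) / D \<le> g F + real m / real (card E)"
    if F: "drawable s E m F" for F
  proof -
    have "g (add_mset e F) = g F + of_bool (e \<in># F)" for e
      by (simp add: g_def insert_absorb)
    then have "(\<Sum>e\<in>E. urn_weight s F e * g (add_mset e F)) =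
        (\<Sum>e\<in>E. urn_weight s F e) * g F + (\<Sum>e\<in>E. urn_weight s F e * of_bool (e \<in># F))"
      by (simp add: distrib_left sum.distrib sum_distrib_right)
    also have "(\<Sum>e\<in>E. urn_weight s F e) = D"
      unfolding D_def using F assms(1) by (intro sum_urn_weight) (auto simp: drawable_def)
    also have "(\<Sum>e\<in>E. urn_weight s F e * of_bool (e \<in># F)) \<le> D * (real m / real (card E))"
    proof (cases s)
      case Without_Replacement
      then have "(\<Sum>e\<in>E. urn_weight s F e * of_bool (e \<in># F)) = 0"
        by (intro sum.neutral) (auto simp: urn_weight_def)
      then show ?thesis using D by simp
    next
      case With_Replacement
      have "E \<inter> {e. e \<in># F} = set_mset F" using F by (auto simp: drawable_def)
      then have "(\<Sum>e\<in>E. urn_weight s F e * of_bool (e \<in># F)) = real (card (set_mset F))"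
        using assms(1) by (simp add: With_Replacement urn_weight_def)
      also have "\<dots> \<le> real m"
        using F size_ge_card_set_mset[of F] by (simp add: drawable_def)
      also have "\<dots> = D * (real m / real (card E))"
        using Suc.prems by (simp add: D_def With_Replacement depletion_def)
      finally show ?thesis .
    qed
    finally show ?thesis using D by (simp add: field_simps)
  qed
  then have "draw_exp s E (Suc m) g \<le> draw_exp s E m (\<lambda>F. g F + real m / real (card E))"
    unfolding draw_exp.simps D_def[symmetric] using Suc.prems by (intro draw_exp_mono) auto
  also have "\<dots> = draw_exp s E m g + real m / real (card E)"
    using Suc.prems assms(1) by (simp only: draw_exp_add draw_exp_const[OF assms(1)])
  also have "\<dots> \<le> (real m)\<^sup>2 / real (card E) + real m / real (card E)"
    using Suc by (simp add: g_def[abs_def])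
  also have "\<dots> \<le> (real (Suc m))\<^sup>2 / real (card E)"
    unfolding add_divide_distrib[symmetric]
    by (intro divide_right_mono) (auto simp: power2_eq_square algebra_simps)
  finally show ?case by (simp add: g_def[abs_def])
qed simp

text \<open>As \<open>q * n\<close> distinct edges force a core, failure needs at least
  \<open>q * n\<close> repetitions among \<open>2 * q * n\<close> draws. Markov's inequality bounds
  this by \<open>8 * q / (n - 1)\<close>.\<close>

lemma core_prob_linear_edges:
  assumes q: "0 < q" and n: "2 \<le> n" and m: "2 * q * n \<le> n choose 2"
  shows "1 - 16 * real q / real n \<le> core_prob s q n (2 * q * n)"
proof -
  let ?E = "all_edges n" and ?m = "2 * q * n"
  define f where "f F = (of_bool (has_core q ({..<n}, set_mset F)) :: real)" for F
  have mE: "?m \<le> card ?E" using m by (simp add: card_all_edges)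
  have pos: "0 < real (q * n)" using q n by simp
  have "draw_exp s ?E ?m (\<lambda>F. 1 - f F) \<le>
      draw_exp s ?E ?m (\<lambda>F. (real (size F) - real (card (set_mset F))) / real (q * n))"
  proof (intro draw_exp_mono mE)
    fix F assume F: "drawable s ?E ?m F"
    have le: "card (set_mset F) \<le> size F" by (rule size_ge_card_set_mset)
    show "1 - f F \<le> (real (size F) - real (card (set_mset F))) / real (q * n)"
    proof (cases "q * n \<le> card (set_mset F)")
      case True
      have "simple_graph ({..<n}, set_mset F)"
        using F by (auto simp: simple_graph_def drawable_def all_edges_def)
      then have "f F = 1"
        unfolding f_def using True n by (auto intro!: dense_graph_has_core simp: lessThan_empty_iff)
      then show ?thesis using le by simp
    next
      case False
      then have "real (q * n) \<le> real (size F) - real (card (set_mset F))"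
        using F by (simp add: drawable_def flip: of_nat_mult)
      then have "1 \<le> (real (size F) - real (card (set_mset F))) / real (q * n)"
        using pos by (simp add: le_divide_eq)
      moreover have "0 \<le> f F" by (simp add: f_def)
      ultimately show ?thesis by linarith
    qed
  qed
  also have "\<dots> \<le> ((real ?m)\<^sup>2 / real (card ?E)) / real (q * n)"
    unfolding draw_exp_divide using pos
    by (intro divide_right_mono draw_exp_repetitions mE) auto
  also have "\<dots> = 8 * real q / (real n - 1)"
    using q n unfolding card_all_edges real_choose_two
    by (simp add: power2_eq_square field_simps)
  also have "\<dots> \<le> 16 * real q / real n"
    using n mult_right_mono[of 2 "real n" "real q"] by (simp add: field_simps)
  finally have "draw_exp s ?E ?m (\<lambda>F. 1 - f F) \<le> 16 * real q / real n" .
  moreover have "draw_exp s ?E ?m (\<lambda>F. 1 - f F) = 1 - draw_exp s ?E ?m f"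
    by (simp only: draw_exp_diff draw_exp_const[OF finite_all_edges mE])
  moreover have "core_prob s q n ?m = draw_exp s ?E ?m f"
    unfolding f_def using m n by (intro core_prob_draw_exp) auto
  ultimately show ?thesis by linarith
qed

section \<open>From single steps to the width of the transition\<close>

lemma core_prob_0:
  assumes "0 < q" "2 \<le> n"
  shows "core_prob s q n 0 = 0"
  using assms by (subst core_prob_draw_exp) (auto simp: not_has_core_no_edges)

text \<open>Between the edge count just below the lower threshold and the upper threshold the
  probability gains \<open>1 - 2 * \<epsilon>\<close>, at bounded speed. Starting one edge below the
  threshold costs the \<open>- 1\<close>.\<close>

lemma characteristic_width_ge:
  assumes q: "2 \<le> q" and \<epsilon>: "0 < \<epsilon>" "\<epsilon> < 1 / 2"
    and n: "8 * q + 5 \<le> n" "16 * real q / \<epsilon> \<le> real n"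
  shows "(1 - 2 * \<epsilon>) * sqrt (real n) / (6 * exp (16 * real q)) - 1 \<le> characteristic_width s q \<epsilon> n"
proof -
  define M where "M = 2 * q * n"
  define P where "P r m \<longleftrightarrow> can_draw s n m \<and> r \<le> core_prob s q n m" for r m
  define a b where "a = (LEAST m. P \<epsilon> m)" and "b = (LEAST m. P (1 - \<epsilon>) m)"
  have n8: "8 \<le> n" using n q by linarith
  \<comment> \<open>This is where \<open>8 * q + 5 \<le> n\<close> is used:
    \<open>8 * q * n \<le> n * (n - 5) \<le> (n - 2) * (n - 3)\<close>.\<close>
  have M1: "2 * M \<le> (n - 2) choose 2"
  proof -
    have "real n * (8 * real q) \<le> real n * (real n - 5)"
      using n(1) by (intro mult_left_mono) auto
    then have "2 * real M \<le> real ((n - 2) choose 2)"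
      using n8 unfolding real_choose_two M_def by (simp add: of_nat_diff field_simps)
    then show ?thesis by linarith
  qed
  then have MN: "M \<le> n choose 2"
    using choose_two_diff_le[of n] by linarith
  have draw: "can_draw s n m" if "m \<le> M" for m
    using that MN n8 by (cases s) auto
  have "16 * real q / real n \<le> \<epsilon>"
    using n(2) n8 \<epsilon> by (simp add: field_simps)
  then have "1 - \<epsilon> \<le> core_prob s q n M"
    using core_prob_linear_edges[of q n s] MN n8 q unfolding M_def by fastforce
  then have PM: "P (1 - \<epsilon>) M" using draw by (simp add: P_def)
  then have b: "P (1 - \<epsilon>) b" "b \<le> M" unfolding b_def by (auto intro: LeastI Least_le)
  then have Pb: "P \<epsilon> b" using \<epsilon> by (simp add: P_def)
  then have a: "P \<epsilon> a" "a \<le> b" unfolding a_def by (auto intro: LeastI Least_le)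
  have "a \<noteq> 0"
  proof
    assume "a = 0"
    then show False
      using a(1) core_prob_0[of q n s] q n8 \<epsilon> by (simp add: P_def)
  qed
  then obtain a' where a': "a = Suc a'" using not0_implies_Suc by blast
  \<comment> \<open>Since \<open>a'\<close> edges can be drawn, minimality of \<open>a\<close> means
    that the probability at \<open>a'\<close> is below \<open>\<epsilon>\<close>.\<close>
  then have "\<not> P \<epsilon> a'" unfolding a_def using not_less_Least[of a' "P \<epsilon>"] by simp
  then have "core_prob s q n a' < \<epsilon>"
    using draw[of a'] a' a b by (simp add: P_def)
  then have "1 - 2 * \<epsilon> \<le> core_prob s q n b - core_prob s q n a'"
    using b(1) by (simp add: P_def)
  also have "\<dots> \<le> real (b - a') * (6 * exp (8 * (2 * real q)) / sqrt (real n))"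
    using a a' b by (intro core_prob_diff_le[OF n8 M1 _ q]) (auto simp: M_def)
  finally have "1 - 2 * \<epsilon> \<le> real (b - a') * (6 * exp (16 * real q) / sqrt (real n))" by simp
  then have "(1 - 2 * \<epsilon>) * sqrt (real n) / (6 * exp (16 * real q)) \<le> real (b - a')"
    using n8 by (simp add: field_simps)
  moreover have "real (b - a') = real b - real a + 1" using a a' by simp
  moreover have "characteristic_width s q \<epsilon> n = real b - real a"
    by (simp add: characteristic_width_def core_threshold_def a_def b_def P_def)
  ultimately show ?thesis by linarith
qed

theorem corollary5:
  fixes q :: nat and s :: sampling and \<epsilon> :: real
  assumes "q \<ge> 3" and "0 < \<epsilon>" and "\<epsilon> < 1 / 2"
  shows "\<exists>c>0. \<forall>\<^sub>F n in sequentially. characteristic_width s q \<epsilon> n \<ge> c * sqrt (real n)"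
proof -
  \<comment> \<open>Half of \<open>k\<close> is given up to absorb the \<open>- 1\<close>, once
    \<open>sqrt n\<close> reaches \<open>2 / k\<close>.\<close>
  define k where "k = (1 - 2 * \<epsilon>) / (6 * exp (16 * real q))"
  have k: "0 < k" using assms by (simp add: k_def)
  have large: "\<forall>\<^sub>F n in sequentially. x \<le> real n" for x
    using filterlim_real_sequentially by (simp add: filterlim_at_top)
  have "\<forall>\<^sub>F n in sequentially. k / 2 * sqrt (real n) \<le> characteristic_width s q \<epsilon> n"
    using large[of "16 * real q / \<epsilon>"] large[of "(2 / k)\<^sup>2"] eventually_ge_at_top[of "8 * q + 5"]
  proof eventually_elim
    case (elim n)
    have "2 / k \<le> sqrt (real n)" using elim(2) by (rule real_le_rsqrt)
    then have "1 \<le> k / 2 * sqrt (real n)" using k by (simp add: field_simps)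
    moreover have "k * sqrt (real n) - 1 \<le> characteristic_width s q \<epsilon> n"
      using characteristic_width_ge[of q \<epsilon> n s] assms elim by (simp add: k_def)
    ultimately show ?case by (simp add: field_simps)
  qed
  then show ?thesis using k by (intro exI[of _ "k / 2"]) auto
qed

end
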